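(* Let $G$ be a unicyclic graph whose unique cycle is the odd cycle $C_{2n+1}=(x_1,\ldots,x_{2n+1})$, $n\ge 1$, and let $I=I(G)\subset R$ be its edge ideal. Let $s\in\mathbb{N}$ with $s\ge n+1$, and let $\mathfrak{m}$ be the maximal homogeneous ideal of $R$ generated by the elements of $V(G)$. Then $\mathfrak{m}^{\gamma}I^{(s)}\subseteq I^s$ for some non-negative integer $\gamma=\gamma(s)$ if and only if every vertex of $G$ lies in $N_G[V(C_{2n+1})]$.
   Context: A unicyclic graph is a finite simple connected graph containing exactly one cycle. $R=\mathbb{K}[V(G)]$ is the polynomial ring over a field $\mathbb{K}$ whose variables are the vertices of $G$; the edge ideal is $I(G)=\langle uv : \{u,v\}\in E(G)\rangle\subset R$. The $s$-th symbolic power of $I$ is $I^{(s)}=\bigcap_{p\in\operatorname{Ass} I}(I^sR_p\cap R)$. For $W\subseteq V(G)$, $N_G[W]$ denotes the closed neighbourhood of $W$: the union of $W$ with the set of all vertices adjacent to some vertex of $W$. *)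

theory Defs
  imports "HOL-Library.Poly_Mapping" "HOL-Algebra.Ideal_Product" "HOL-Algebra.Algebraic_Closure_Type"
begin

section \<open>Graphs\<close>

text \<open>A graph is given by its set of edges; its vertex set is the whole finite type \<open>'v\<close>.\<close>

definition simple_graph :: "'v::finite set set \<Rightarrow> bool" where
  "simple_graph E \<longleftrightarrow> (\<forall>e\<in>E. card e = 2)"

definition connected_graph :: "'v::finite set set \<Rightarrow> bool" where
  "connected_graph E \<longleftrightarrow> (\<forall>u v. (u, v) \<in> {(a, b). {a, b} \<in> E}\<^sup>*)"

definition cycle_edges :: "'v list \<Rightarrow> 'v set set" where
  "cycle_edges xs = {{xs ! i, xs ! (Suc i mod length xs)} | i. i < length xs}"

definition is_cycle :: "'v set set \<Rightarrow> 'v list \<Rightarrow> bool" where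
  "is_cycle E xs \<longleftrightarrow> length xs \<ge> 3 \<and> distinct xs \<and> cycle_edges xs \<subseteq> E"

text \<open>Rotating or reversing \<open>xs\<close> gives the same cycle, so cycles are
  counted as subgraphs, through their edge sets.\<close>

definition unicyclic :: "'v::finite set set \<Rightarrow> bool" where
  "unicyclic E \<longleftrightarrow> simple_graph E \<and> connected_graph E \<and>
     (\<exists>!C. \<exists>xs. is_cycle E xs \<and> C = cycle_edges xs)"

definition closed_nbhd :: "'v set set \<Rightarrow> 'v set \<Rightarrow> 'v set" where
  "closed_nbhd E W = W \<union> {v. \<exists>w\<in>W. {v, w} \<in> E}"


section \<open>Localisation and symbolic powers\<close>

definition frac_rel :: "('a, 'b) ring_scheme \<Rightarrow> 'a set \<Rightarrow> (('a \<times> 'a) \<times> ('a \<times> 'a)) set" where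
  "frac_rel R S = {((a, s), (b, t)). a \<in> carrier R \<and> s \<in> S \<and> b \<in> carrier R \<and> t \<in> S \<and>
     (\<exists>u\<in>S. u \<otimes>\<^bsub>R\<^esub> (a \<otimes>\<^bsub>R\<^esub> t) = u \<otimes>\<^bsub>R\<^esub> (b \<otimes>\<^bsub>R\<^esub> s))}"

text \<open>The fraction \<open>a / s\<close>.\<close>

definition fraction :: "('a, 'b) ring_scheme \<Rightarrow> 'a set \<Rightarrow> 'a \<Rightarrow> 'a \<Rightarrow> ('a \<times> 'a) set" where
  "fraction R S a s = frac_rel R S `` {(a, s)}"

text \<open>The ring of fractions with denominators in the multiplicative set \<open>S\<close>.\<close>

definition localization :: "('a, 'b) ring_scheme \<Rightarrow> 'a set \<Rightarrow> ('a \<times> 'a) set ring" where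
  "localization R S =
    \<lparr>carrier = (carrier R \<times> S) // frac_rel R S,
     monoid.mult = (\<lambda>P Q. \<Union>{fraction R S (a \<otimes>\<^bsub>R\<^esub> b) (s \<otimes>\<^bsub>R\<^esub> t) | a s b t. (a, s) \<in> P \<and> (b, t) \<in> Q}),
     one = fraction R S \<one>\<^bsub>R\<^esub> \<one>\<^bsub>R\<^esub>,
     zero = fraction R S \<zero>\<^bsub>R\<^esub> \<one>\<^bsub>R\<^esub>,
     add = (\<lambda>P Q. \<Union>{fraction R S (a \<otimes>\<^bsub>R\<^esub> t \<oplus>\<^bsub>R\<^esub> b \<otimes>\<^bsub>R\<^esub> s) (s \<otimes>\<^bsub>R\<^esub> t) | a s b t.
       (a, s) \<in> P \<and> (b, t) \<in> Q})\<rparr>"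

text \<open>For a prime ideal \<open>p\<close>, the contraction \<open>J R\<^sub>p \<inter> R\<close> of the extension of \<open>J\<close>,
  i.e. its preimage under the canonical map \<open>R \<rightarrow> R\<^sub>p\<close>.\<close>

definition localized_contraction :: "('a, 'b) ring_scheme \<Rightarrow> 'a set \<Rightarrow> 'a set \<Rightarrow> 'a set" where
  "localized_contraction R p J =
    (let S = carrier R - p; \<iota> = (\<lambda>a. fraction R S a \<one>\<^bsub>R\<^esub>)
     in {f \<in> carrier R. \<iota> f \<in> genideal (localization R S) (\<iota> ` J)})"

text \<open>\<open>Ass I\<close>: the associated primes of the \<open>R\<close>-module \<open>R/I\<close>, i.e. the prime ideals that are
  annihilators \<open>(I : f)\<close> of a residue class \<open>f + I\<close>.\<close>

definition associated_primes :: "('a, 'b) ring_scheme \<Rightarrow> 'a set \<Rightarrow> 'a set set" where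
  "associated_primes R I =
    {p. primeideal p R \<and> (\<exists>f\<in>carrier R. p = {r \<in> carrier R. r \<otimes>\<^bsub>R\<^esub> f \<in> I})}"

definition ideal_power :: "('a, 'b) ring_scheme \<Rightarrow> 'a set \<Rightarrow> nat \<Rightarrow> 'a set" where
  "ideal_power R I k = I [^]\<^bsub>ideals_set R\<^esub> k"

text \<open>Intersecting with the carrier only matters if there are no associated primes,
  i.e. if \<open>I = R\<close>.\<close>

definition symbolic_power :: "('a, 'b) ring_scheme \<Rightarrow> 'a set \<Rightarrow> nat \<Rightarrow> 'a set" where
  "symbolic_power R I k =
    carrier R \<inter> (\<Inter>p\<in>associated_primes R I. localized_contraction R p (ideal_power R I k))"


section \<open>Edge ideals\<close>

text \<open>Polynomials in the variables \<open>'v\<close>: finitely supported coefficient functions on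
  monomials, which are in turn finitely supported exponent functions.\<close>

type_synonym ('v, 'k) polynomials = "('v \<Rightarrow>\<^sub>0 nat) \<Rightarrow>\<^sub>0 'k"

abbreviation vertex_ring :: "('v, 'k::field) polynomials ring" where
  "vertex_ring \<equiv> ring_of_type_algebra"

definition var :: "'v \<Rightarrow> ('v, 'k::field) polynomials" where
  "var v = Poly_Mapping.single (Poly_Mapping.single v 1) 1"

definition edge_ideal :: "'v set set \<Rightarrow> ('v, 'k::field) polynomials set" where
  "edge_ideal E = genideal vertex_ring {var u * var v | u v. {u, v} \<in> E}"

definition max_ideal :: "('v, 'k::field) polynomials set" where
  "max_ideal = genideal vertex_ring (range var)"

end

theory Submission
  imports Defs
begin

text \<open>All ideals involved are monomial. A prime associated to the edge ideal contains exactly the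
  variables of a vertex cover, and every variable in it has a neighbour outside it; hence a monomial
  lies in the \<open>s\<close>-th symbolic power iff all vertex covers have weight at least \<open>s\<close> under its exponents.
  If every vertex is adjacent to the cycle, multiply such a monomial by one of degree
  \<open>s \<bar>V(G)\<bar>\<close>: some vertex \<open>v\<close> then has weight at least \<open>s\<close>. Split off edges at \<open>v\<close>
  until its neighbours, one of which lies on the cycle, are used up; the rest is supported on a
  forest, where \<open>s\<close> edges can be found by Koenig duality.
  If \<open>z\<close> is not adjacent to the cycle, then the product of all cycle vertices and \<open>s - n - 1\<close>
  copies of a cycle edge lies in the symbolic power but has degree \<open>2s - 1\<close> on the cycle, and
  powers of \<open>z\<close> contribute no edges.\<close>

section \<open>Localisation\<close>

lemma ring_of_type_algebra_simps [simp]: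
  "carrier ring_of_type_algebra = UNIV"
  "x \<otimes>\<^bsub>ring_of_type_algebra\<^esub> y = x * y"
  "\<one>\<^bsub>ring_of_type_algebra\<^esub> = 1"
  "\<zero>\<^bsub>ring_of_type_algebra\<^esub> = 0"
  "x \<oplus>\<^bsub>ring_of_type_algebra\<^esub> y = x + y"
  by (simp_all add: ring_of_type_algebra_def)

text \<open>Closure under negation, which \<open>idealI\<close> asks for, comes from scaling by
  -1.\<close>

lemma ideal_of_type_algebraI:
  fixes J :: "'a::comm_ring_1 set"
  assumes "0 \<in> J" "\<And>a b. a \<in> J \<Longrightarrow> b \<in> J \<Longrightarrow> a + b \<in> J" "\<And>r a. a \<in> J \<Longrightarrow> r * a \<in> J"
  shows "ideal J ring_of_type_algebra"
proof -
  interpret R: cring "ring_of_type_algebra :: 'a ring" ..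
  have neg: "\<ominus>\<^bsub>ring_of_type_algebra\<^esub> a = - a" for a :: 'a
    by (rule R.minus_equality) auto
  show ?thesis
    by (intro idealI R.ring_axioms R.add.subgroupI)
      (use assms assms(3)[of _ "-1"] neg in \<open>auto simp: mult.commute simp flip: a_inv_def\<close>)
qed

lemma ideal_of_type_algebraD:
  fixes J :: "'a::comm_ring_1 set"
  assumes "ideal J ring_of_type_algebra"
  shows "0 \<in> J" "a \<in> J \<Longrightarrow> b \<in> J \<Longrightarrow> a + b \<in> J" "a \<in> J \<Longrightarrow> r * a \<in> J"
proof -
  interpret ideal J ring_of_type_algebra by fact
  show "0 \<in> J" using additive_subgroup.zero_closed[OF ideal.axioms(1)[OF assms]] by simp
  show "a \<in> J \<Longrightarrow> b \<in> J \<Longrightarrow> a + b \<in> J" using additive_subgroup.a_closed[OF ideal.axioms(1)[OF assms], of a b] by simp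
  show "a \<in> J \<Longrightarrow> r * a \<in> J" using I_l_closed[of a r] by simp
qed

section \<open>Rings of fractions at a multiplicative set\<close>

locale mult_closed =
  fixes S :: "'a::comm_ring_1 set"
  assumes one_in: "1 \<in> S" and mult_in: "s \<in> S \<Longrightarrow> t \<in> S \<Longrightarrow> s * t \<in> S"
begin

abbreviation frac :: "'a \<Rightarrow> 'a \<Rightarrow> ('a \<times> 'a) set" where
  "frac \<equiv> fraction ring_of_type_algebra S"

abbreviation loc :: "('a \<times> 'a) set ring" where
  "loc \<equiv> localization ring_of_type_algebra S"

lemma equiv_frac_rel: "equiv (UNIV \<times> S) (frac_rel ring_of_type_algebra S)"
proof (rule equivI)
  show "refl_on (UNIV \<times> S) (frac_rel ring_of_type_algebra S)"
    using one_in by (auto simp: refl_on_def frac_rel_def)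
  show "frac_rel ring_of_type_algebra S \<subseteq> (UNIV \<times> S) \<times> UNIV \<times> S"
    by (auto simp: frac_rel_def)
  show "sym (frac_rel ring_of_type_algebra S)"
    unfolding sym_def frac_rel_def by (auto intro: sym)
  show "trans (frac_rel ring_of_type_algebra S)"
  proof (rule transI, clarsimp simp: frac_rel_def)
    fix a s b t c r u v
    assume *: "s \<in> S" "t \<in> S" "r \<in> S" "u \<in> S" "v \<in> S"
      and uv: "u * (a * t) = u * (b * s)" "v * (b * r) = v * (c * t)"
    \<comment> \<open>Denominators cannot be cancelled, so the middle one, \<open>t\<close>, goes
      into the witness.\<close>
    have "(u * v * t) * (a * r) = (v * r) * (u * (a * t))" by (simp add: ac_simps)
    also have "\<dots> = (u * s) * (v * (b * r))" unfolding uv(1) by (simp add: ac_simps)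
    also have "\<dots> = (u * v * t) * (c * s)" unfolding uv(2) by (simp add: ac_simps)
    finally show "\<exists>w\<in>S. w * (a * r) = w * (c * s)" using * mult_in by blast
  qed
qed

lemma frac_eq_iff:
  "s \<in> S \<Longrightarrow> t \<in> S \<Longrightarrow> frac a s = frac b t \<longleftrightarrow> (\<exists>u\<in>S. u * (a * t) = u * (b * s))"
  unfolding fraction_def
  by (subst eq_equiv_class_iff[OF equiv_frac_rel]) (simp_all add: frac_rel_def)

lemma frac_eqI: "s \<in> S \<Longrightarrow> t \<in> S \<Longrightarrow> a * t = b * s \<Longrightarrow> frac a s = frac b t"
  using frac_eq_iff one_in by auto

lemma mem_frac_iff: "s \<in> S \<Longrightarrow> (b, t) \<in> frac a s \<longleftrightarrow> t \<in> S \<and> frac a s = frac b t"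
  using frac_eq_iff[of s t a b] by (auto simp: fraction_def frac_rel_def)

lemma carrier_loc: "carrier loc = {frac a s | a s. s \<in> S}"
  by (auto simp: localization_def quotient_def fraction_def)

lemma frac_in_carrier: "s \<in> S \<Longrightarrow> frac a s \<in> carrier loc"
  by (auto simp: carrier_loc)

text \<open>The product in \<open>localization\<close> is a union over all representatives of both
  classes. They all give the same class, so the union collapses to it.\<close>

lemma mult_frac:
  assumes "s \<in> S" "t \<in> S"
  shows "frac a s \<otimes>\<^bsub>loc\<^esub> frac b t = frac (a * b) (s * t)"
proof -
  have "frac (a' * b') (s' * t') = frac (a * b) (s * t)"
    if "(a', s') \<in> frac a s" "(b', t') \<in> frac b t" for a' s' b' t'
  proof -
    from that assms obtain u v where *: "s' \<in> S" "t' \<in> S" "u \<in> S" "v \<in> S"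
      and uv: "u * (a * s') = u * (a' * s)" "v * (b * t') = v * (b' * t)"
      by (auto simp: mem_frac_iff frac_eq_iff)
    have "(u * v) * ((a' * b') * (s * t)) = (u * (a' * s)) * (v * (b' * t))"
      by (simp add: ac_simps)
    also have "\<dots> = (u * v) * ((a * b) * (s' * t'))"
      unfolding uv[symmetric] by (simp add: ac_simps)
    finally show ?thesis using * assms mult_in by (auto simp: frac_eq_iff)
  qed
  moreover have "(a, s) \<in> frac a s" "(b, t) \<in> frac b t"
    using assms by (simp_all add: mem_frac_iff)
  ultimately have "{frac (a' * b') (s' * t') | a' s' b' t'.
      (a', s') \<in> frac a s \<and> (b', t') \<in> frac b t} = {frac (a * b) (s * t)}"
    by (blast intro: sym)
  then show ?thesis by (simp add: localization_def)
qed

lemma add_frac: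
  assumes "s \<in> S" "t \<in> S"
  shows "frac a s \<oplus>\<^bsub>loc\<^esub> frac b t = frac (a * t + b * s) (s * t)"
proof -
  have "frac (a' * t' + b' * s') (s' * t') = frac (a * t + b * s) (s * t)"
    if "(a', s') \<in> frac a s" "(b', t') \<in> frac b t" for a' s' b' t'
  proof -
    from that assms obtain u v where *: "s' \<in> S" "t' \<in> S" "u \<in> S" "v \<in> S"
      and uv: "u * (a * s') = u * (a' * s)" "v * (b * t') = v * (b' * t)"
      by (auto simp: mem_frac_iff frac_eq_iff)
    have "(u * v) * ((a' * t' + b' * s') * (s * t)) =
        (u * (a' * s)) * (v * t * t') + (v * (b' * t)) * (u * s * s')"
      by (simp add: algebra_simps)
    also have "\<dots> = (u * v) * ((a * t + b * s) * (s' * t'))"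
      unfolding uv[symmetric] by (simp add: algebra_simps)
    finally show ?thesis using * assms mult_in by (auto simp: frac_eq_iff)
  qed
  moreover have "(a, s) \<in> frac a s" "(b, t) \<in> frac b t"
    using assms by (simp_all add: mem_frac_iff)
  ultimately have "{frac (a' * t' + b' * s') (s' * t') | a' s' b' t'.
      (a', s') \<in> frac a s \<and> (b', t') \<in> frac b t} = {frac (a * t + b * s) (s * t)}"
    by (blast intro: sym)
  then show ?thesis by (simp add: localization_def)
qed

lemma one_loc: "\<one>\<^bsub>loc\<^esub> = frac 1 1" and zero_loc: "\<zero>\<^bsub>loc\<^esub> = frac 0 1"
  by (simp_all add: localization_def)

lemma cring_loc: "cring loc"
proof (rule cringI)
  show "abelian_group loc"
  proof (rule abelian_groupI)
    fix x assume "x \<in> carrier loc"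
    then obtain a s where x: "x = frac a s" "s \<in> S" by (auto simp: carrier_loc)
    then have "frac (- a) s \<oplus>\<^bsub>loc\<^esub> x = \<zero>\<^bsub>loc\<^esub>"
      by (simp add: add_frac zero_loc, intro frac_eqI) (auto intro: one_in mult_in)
    then show "\<exists>y\<in>carrier loc. y \<oplus>\<^bsub>loc\<^esub> x = \<zero>\<^bsub>loc\<^esub>"
      using x frac_in_carrier by blast
  qed (use one_in mult_in in \<open>fastforce simp: carrier_loc add_frac zero_loc algebra_simps\<close>)+
  show "comm_monoid loc"
    by (rule comm_monoidI)
      (use one_in mult_in in \<open>fastforce simp: carrier_loc mult_frac one_loc algebra_simps\<close>)+
  fix x y z assume "x \<in> carrier loc" "y \<in> carrier loc" "z \<in> carrier loc"
  then obtain a s b t c r where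
    "x = frac a s" "y = frac b t" "z = frac c r" "s \<in> S" "t \<in> S" "r \<in> S"
    by (auto simp: carrier_loc)
  then show "(x \<oplus>\<^bsub>loc\<^esub> y) \<otimes>\<^bsub>loc\<^esub> z = x \<otimes>\<^bsub>loc\<^esub> z \<oplus>\<^bsub>loc\<^esub> y \<otimes>\<^bsub>loc\<^esub> z"
    by (simp add: mult_frac add_frac mult_in, intro frac_eqI)
      (auto simp: algebra_simps intro!: mult_in)
qed

text \<open>Common denominators keep sums of such fractions in this form. The set therefore bounds
  the ideal generated by the image of \<open>K\<close> from above.\<close>

lemma ideal_extension:
  assumes K: "ideal K ring_of_type_algebra"
  shows "ideal {frac a t | a t. a \<in> K \<and> t \<in> S} loc" (is "ideal ?J _")
proof -
  interpret L: cring loc by (rule cring_loc)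
  note K' = ideal_of_type_algebraD[OF K]
  have mult: "x \<otimes>\<^bsub>loc\<^esub> y \<in> ?J" if "x \<in> carrier loc" "y \<in> ?J" for x y
    using that K' mult_in by (auto simp: carrier_loc mult_frac) blast
  have J_carrier: "?J \<subseteq> carrier loc" by (auto simp: carrier_loc)
  show ?thesis
  proof (intro idealI L.ring_axioms L.add.subgroupI J_carrier)
    show "?J \<noteq> {}" using K' one_in by blast
    fix x y assume "x \<in> ?J" "y \<in> ?J"
    then obtain a s b t where x: "x = frac a s" "a \<in> K" "s \<in> S" and y: "y = frac b t" "b \<in> K" "t \<in> S"
      by blast
    then have "a * t + b * s \<in> K" using K' by (simp add: mult.commute)
    then show "x \<oplus>\<^bsub>loc\<^esub> y \<in> ?J" using x y mult_in by (auto simp: add_frac)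
  next
    fix x assume x: "x \<in> ?J"
    \<comment> \<open>Negation is multiplication by the ring element -1, so absorption covers
      it.\<close>
    then have eq: "\<ominus>\<^bsub>loc\<^esub> x = (\<ominus>\<^bsub>loc\<^esub> \<one>\<^bsub>loc\<^esub>) \<otimes>\<^bsub>loc\<^esub> x"
      using J_carrier by (simp add: L.l_minus subset_eq)
    show "\<ominus>\<^bsub>loc\<^esub> x \<in> ?J"
      unfolding eq by (rule mult[OF L.a_inv_closed[OF L.one_closed] x])
  next
    fix a x assume "a \<in> ?J" "x \<in> carrier loc"
    then have "x \<otimes>\<^bsub>loc\<^esub> a \<in> ?J" "a \<otimes>\<^bsub>loc\<^esub> x = x \<otimes>\<^bsub>loc\<^esub> a"
      using J_carrier mult[of x a] L.m_comm[of a x] by (simp_all only: subset_eq)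
    then show "x \<otimes>\<^bsub>loc\<^esub> a \<in> ?J" "a \<otimes>\<^bsub>loc\<^esub> x \<in> ?J" by simp_all
  qed
qed

text \<open>An element of the extended ideal is a single fraction with numerator in
  \<open>K\<close>, and clearing denominators gives the multiplier. Conversely, \<open>u * f\<close>
  is brought back to \<open>f\<close> by the scalar \<open>frac 1 u\<close>.\<close>

lemma frac_mem_extension_iff:
  assumes K: "ideal K ring_of_type_algebra"
  shows "frac f 1 \<in> genideal loc ((\<lambda>a. frac a 1) ` K) \<longleftrightarrow> (\<exists>u\<in>S. u * f \<in> K)"
proof
  interpret L: cring loc by (rule cring_loc)
  assume "frac f 1 \<in> genideal loc ((\<lambda>a. frac a 1) ` K)"
  also have "genideal loc ((\<lambda>a. frac a 1) ` K) \<subseteq> {frac a t | a t. a \<in> K \<and> t \<in> S}"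
    by (intro L.genideal_minimal ideal_extension K) (use one_in in blast)
  finally obtain a t where "frac f 1 = frac a t" "a \<in> K" "t \<in> S" by blast
  then obtain u where "u \<in> S" "u * (f * t) = u * a"
    using one_in by (auto simp: frac_eq_iff)
  then have "(u * t) * f \<in> K"
    using ideal_of_type_algebraD(3)[OF K \<open>a \<in> K\<close>, of u] by (simp add: ac_simps)
  then show "\<exists>u\<in>S. u * f \<in> K" using \<open>u \<in> S\<close> \<open>t \<in> S\<close> mult_in by blast
next
  interpret L: cring loc by (rule cring_loc)
  assume "\<exists>u\<in>S. u * f \<in> K"
  then obtain u where u: "u \<in> S" "u * f \<in> K" by blast
  have sub: "(\<lambda>a. frac a 1) ` K \<subseteq> carrier loc"
    using frac_in_carrier one_in by blast
  have "frac (u * f) 1 \<in> genideal loc ((\<lambda>a. frac a 1) ` K)"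
    using L.genideal_self[OF sub] u by blast
  then have "frac 1 u \<otimes>\<^bsub>loc\<^esub> frac (u * f) 1 \<in> genideal loc ((\<lambda>a. frac a 1) ` K)"
    using ideal.I_l_closed[OF L.genideal_ideal[OF sub]] frac_in_carrier u by blast
  moreover have "frac 1 u \<otimes>\<^bsub>loc\<^esub> frac (u * f) 1 = frac f 1"
    by (simp add: mult_frac u one_in, intro frac_eqI) (simp_all add: u one_in ac_simps)
  ultimately show "frac f 1 \<in> genideal loc ((\<lambda>a. frac a 1) ` K)" by simp
qed

end

lemma prime_of_type_algebraD:
  fixes p :: "'a::comm_ring_1 set"
  assumes "primeideal p ring_of_type_algebra"
  shows "1 \<notin> p" "a * b \<in> p \<Longrightarrow> a \<in> p \<or> b \<in> p"
proof -
  interpret primeideal p ring_of_type_algebra by fact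
  show "1 \<notin> p" "a * b \<in> p \<Longrightarrow> a \<in> p \<or> b \<in> p"
    using I_notcarr one_imp_carrier I_prime[of a b] by auto
qed

text \<open>Removes fractions from the rest of the argument: a multiplier outside \<open>p\<close>
  does the work of localising.\<close>

lemma localized_contraction_iff:
  fixes p :: "'a::comm_ring_1 set"
  assumes p: "primeideal p ring_of_type_algebra" and K: "ideal K ring_of_type_algebra"
  shows "f \<in> localized_contraction ring_of_type_algebra p K \<longleftrightarrow> (\<exists>u. u \<notin> p \<and> u * f \<in> K)"
proof -
  interpret mult_closed "UNIV - p"
    using prime_of_type_algebraD[OF p] by unfold_locales auto
  show ?thesis
    using frac_mem_extension_iff[OF K, of f] by (auto simp: localized_contraction_def Let_def)
qed

section \<open>Monomial ideals\<close>

text \<open>Encodes a monomial ideal by its set of exponents, so that products and powers of ideals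
  turn into sums of sets. It is an ideal once \<open>A\<close> is \<open>up_closed\<close>.\<close>

definition mono_ideal :: "'m::comm_monoid_add set \<Rightarrow> ('m \<Rightarrow>\<^sub>0 'k::field) set" where
  "mono_ideal A = {f. Poly_Mapping.keys f \<subseteq> A}"

definition up_closed :: "'m::comm_monoid_add set \<Rightarrow> bool" where
  "up_closed A \<longleftrightarrow> (\<forall>a\<in>A. \<forall>b. a + b \<in> A)"

definition sumset :: "'m::comm_monoid_add set \<Rightarrow> 'm set \<Rightarrow> 'm set" where
  "sumset A B = {a + b | a b. a \<in> A \<and> b \<in> B}"

text \<open>The base case is \<open>UNIV\<close> because the zeroth power of an ideal is the whole
  ring.\<close>

fun sumset_pow :: "'m::comm_monoid_add set \<Rightarrow> nat \<Rightarrow> 'm set" where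
  "sumset_pow A 0 = UNIV"
| "sumset_pow A (Suc k) = sumset (sumset_pow A k) A"

lemma sumsetI: "a \<in> A \<Longrightarrow> b \<in> B \<Longrightarrow> a + b \<in> sumset A B"
  by (auto simp: sumset_def)

lemma up_closed_sumset: "up_closed B \<Longrightarrow> up_closed (sumset A B)"
  unfolding up_closed_def sumset_def by clarify (metis add.assoc)

lemma up_closed_sumset_pow: "up_closed A \<Longrightarrow> up_closed (sumset_pow A k)"
  by (cases k) (auto simp: up_closed_sumset up_closed_def[of UNIV])

lemma ideal_mono_ideal:
  assumes "up_closed A"
  shows "ideal (mono_ideal A :: ('m::comm_monoid_add \<Rightarrow>\<^sub>0 'k::field) set) ring_of_type_algebra"
proof (rule ideal_of_type_algebraI)
  fix r f :: "'m \<Rightarrow>\<^sub>0 'k" assume "f \<in> mono_ideal A"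
  then show "r * f \<in> mono_ideal A"
    using keys_mult[of r f] assms by (fastforce simp: mono_ideal_def up_closed_def add.commute)
next
  fix f g :: "'m \<Rightarrow>\<^sub>0 'k" assume "f \<in> mono_ideal A" "g \<in> mono_ideal A"
  then show "f + g \<in> mono_ideal A"
    using keys_add[of f g] by (auto simp: mono_ideal_def)
qed (simp add: mono_ideal_def)

text \<open>A polynomial is the sum of its terms, and each term is a constant, i.e. a polynomial
  supported at exponent 0, times a monomial of \<open>J\<close>.\<close>

lemma mono_ideal_subset:
  fixes J :: "('m::comm_monoid_add \<Rightarrow>\<^sub>0 'k::field) set"
  assumes J: "ideal J ring_of_type_algebra" and A: "\<And>a. a \<in> A \<Longrightarrow> Poly_Mapping.single a 1 \<in> J"
  shows "mono_ideal A \<subseteq> J"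
proof
  fix f :: "'m \<Rightarrow>\<^sub>0 'k" assume f: "f \<in> mono_ideal A"
  note J' = ideal_of_type_algebraD[OF J]
  have "(\<Sum>a\<in>B. Poly_Mapping.single a (Poly_Mapping.lookup f a)) \<in> J" if "finite B" "B \<subseteq> A" for B
    using that
  proof (induction B rule: finite_induct)
    case (insert a B)
    have "Poly_Mapping.single a (Poly_Mapping.lookup f a) =
        Poly_Mapping.single 0 (Poly_Mapping.lookup f a) * Poly_Mapping.single a 1"
      by (simp add: mult_single)
    also have "\<dots> \<in> J" using insert.prems A J' by blast
    finally show ?case using insert J' by simp
  qed (simp add: J')
  moreover have "f = (\<Sum>a\<in>Poly_Mapping.keys f. Poly_Mapping.single a (Poly_Mapping.lookup f a))"
    by (rule poly_mapping_eqI)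
      (auto simp: lookup_sum lookup_single when_def in_keys_iff sum.delta)
  ultimately show "f \<in> J" using f by (metis finite_keys mono_ideal_def mem_Collect_eq)
qed

lemma single_mem_mono_ideal_iff:
  "(Poly_Mapping.single a 1 :: 'm::comm_monoid_add \<Rightarrow>\<^sub>0 'k::field) \<in> mono_ideal A \<longleftrightarrow> a \<in> A"
  by (simp add: mono_ideal_def)

text \<open>Adding \<open>UNIV\<close> closes the generating exponents upwards, i.e. passes to all
  multiples of the generators.\<close>

lemma genideal_monomials:
  "genideal ring_of_type_algebra ((\<lambda>a. Poly_Mapping.single a 1) ` A) =
    (mono_ideal (sumset A UNIV) :: ('m::comm_monoid_add \<Rightarrow>\<^sub>0 'k::field) set)"
  (is "genideal ?R ?S = _")
proof -
  interpret R: cring ?R ..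
  have ideal: "ideal (genideal ?R ?S) ?R" by (rule R.genideal_ideal) simp
  have self: "?S \<subseteq> genideal ?R ?S" by (rule R.genideal_self) simp
  show ?thesis
  proof
    have "up_closed (UNIV :: 'm set)" by (simp add: up_closed_def)
    moreover have "a \<in> sumset A UNIV" if "a \<in> A" for a
      using sumsetI[OF that UNIV_I, of 0] by simp
    ultimately show "genideal ?R ?S \<subseteq> mono_ideal (sumset A UNIV)"
      by (intro R.genideal_minimal ideal_mono_ideal up_closed_sumset)
        (auto simp: single_mem_mono_ideal_iff)
    show "mono_ideal (sumset A UNIV) \<subseteq> genideal ?R ?S"
    proof (rule mono_ideal_subset[OF ideal])
      fix c assume "c \<in> sumset A UNIV"
      then obtain a b where c: "c = b + a" "a \<in> A" by (auto simp: sumset_def add.commute)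
      have "Poly_Mapping.single b 1 * Poly_Mapping.single a 1 \<in> genideal ?R ?S"
        using self c by (intro ideal_of_type_algebraD(3)[OF ideal]) blast
      then show "Poly_Mapping.single c 1 \<in> genideal ?R ?S" by (simp add: mult_single c)
    qed
  qed
qed

lemma mono_ideal_mult: "f \<in> mono_ideal A \<Longrightarrow> g \<in> mono_ideal B \<Longrightarrow> f * g \<in> mono_ideal (sumset A B)"
  using keys_mult[of f g] by (fastforce simp: mono_ideal_def sumset_def)

lemma ideal_prod_subset:
  fixes J :: "'a::comm_ring_1 set"
  assumes J: "ideal J ring_of_type_algebra" and "\<And>f g. f \<in> A \<Longrightarrow> g \<in> B \<Longrightarrow> f * g \<in> J"
  shows "ideal_prod ring_of_type_algebra A B \<subseteq> J"
proof
  fix f assume "f \<in> ideal_prod ring_of_type_algebra A B"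
  then show "f \<in> J"
    by induction (use assms(2) ideal_of_type_algebraD(2)[OF J] in simp_all)
qed

lemma ideal_prod_mono_ideal:
  assumes "up_closed A" "up_closed B"
  shows "ideal_prod ring_of_type_algebra (mono_ideal A) (mono_ideal B) =
    (mono_ideal (sumset A B) :: ('m::comm_monoid_add \<Rightarrow>\<^sub>0 'k::field) set)" (is "?L = ?M")
proof
  interpret R: cring "ring_of_type_algebra :: ('m \<Rightarrow>\<^sub>0 'k) ring" ..
  show "?L \<subseteq> ?M"
    using assms by (intro ideal_prod_subset ideal_mono_ideal up_closed_sumset mono_ideal_mult)
  show "?M \<subseteq> ?L"
  proof (rule mono_ideal_subset)
    show "ideal ?L ring_of_type_algebra"
      using assms by (intro R.ideal_prod_is_ideal ideal_mono_ideal)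
    fix c assume "c \<in> sumset A B"
    then obtain a b where c: "c = a + b" "a \<in> A" "b \<in> B" by (auto simp: sumset_def)
    then have "(Poly_Mapping.single a 1 :: 'm \<Rightarrow>\<^sub>0 'k) \<otimes>\<^bsub>ring_of_type_algebra\<^esub> Poly_Mapping.single b 1 \<in> ?L"
      by (intro ideal_prod.prod) (simp_all add: single_mem_mono_ideal_iff)
    then show "Poly_Mapping.single c 1 \<in> ?L" by (simp add: mult_single c)
  qed
qed

lemma ideal_power_mono_ideal:
  assumes "up_closed A"
  shows "ideal_power ring_of_type_algebra (mono_ideal A) k =
    (mono_ideal (sumset_pow A k) :: ('m::comm_monoid_add \<Rightarrow>\<^sub>0 'k::field) set)"
proof (induction k)
  case 0
  then show ?case by (simp add: ideal_power_def nat_pow_def ideals_set_def mono_ideal_def)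
next
  case (Suc k)
  have "ideal_power ring_of_type_algebra (mono_ideal A) (Suc k) =
      ideal_prod ring_of_type_algebra (ideal_power ring_of_type_algebra (mono_ideal A) k)
        (mono_ideal A :: ('m \<Rightarrow>\<^sub>0 'k) set)"
    by (simp add: ideal_power_def nat_pow_def ideals_set_def)
  then show ?case using Suc assms by (simp add: ideal_prod_mono_ideal up_closed_sumset_pow)
qed

section \<open>Weighted degrees\<close>

text \<open>One additive functional serves for cover weights (indicator functions), for the total
  degree (constant 1) and for the obstruction in the converse direction (weights 0, 1, 2).\<close>

definition wdeg :: "('v::finite \<Rightarrow> nat) \<Rightarrow> ('v \<Rightarrow>\<^sub>0 nat) \<Rightarrow> nat" where
  "wdeg w m = (\<Sum>v\<in>UNIV. w v * Poly_Mapping.lookup m v)"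

abbreviation unit_exp :: "'v \<Rightarrow> ('v \<Rightarrow>\<^sub>0 nat)" where
  "unit_exp v \<equiv> Poly_Mapping.single v 1"

lemma wdeg_add: "wdeg w (a + b) = wdeg w a + wdeg w b"
  by (simp add: wdeg_def lookup_add distrib_left sum.distrib)

lemma wdeg_zero [simp]: "wdeg w 0 = 0"
  by (simp add: wdeg_def)

lemma wdeg_single [simp]: "wdeg w (Poly_Mapping.single v k) = w v * k"
  by (simp add: wdeg_def lookup_single when_def sum.delta if_distrib cong: if_cong)

lemma wdeg_sum: "wdeg w (sum f A) = (\<Sum>x\<in>A. wdeg w (f x))"
  by (induction A rule: infinite_finite_induct) (simp_all add: wdeg_add)

lemma wdeg_of_bool: "wdeg (\<lambda>v. of_bool (v \<in> W)) m = sum (Poly_Mapping.lookup m) W"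
  unfolding wdeg_def by (subst sum.mono_neutral_cong_right[of UNIV W]) auto

lemma wdeg_sumset_pow:
  assumes "m \<in> sumset_pow A k" "\<And>a. a \<in> A \<Longrightarrow> c \<le> wdeg w a"
  shows "k * c \<le> wdeg w m"
  using assms(1)
proof (induction k arbitrary: m)
  case (Suc k)
  then obtain a b where m: "m = a + b" "a \<in> sumset_pow A k" "b \<in> A" by (auto simp: sumset_def)
  then show ?case using Suc.IH[of a] assms(2)[of b] by (simp add: wdeg_add)
qed simp

section \<open>Products of polynomials without cancellation\<close>

text \<open>If \<open>a + b\<close> splits in only one way along the supports, the convolution has a
  single term and nothing can cancel.\<close>

lemma lookup_mult_unique:
  fixes f g :: "'m::comm_monoid_add \<Rightarrow>\<^sub>0 'k::field"
  assumes "\<And>l q. l \<in> Poly_Mapping.keys f \<Longrightarrow> q \<in> Poly_Mapping.keys g \<Longrightarrow> a + b = l + q \<Longrightarrow> l = a \<and> q = b"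
  shows "Poly_Mapping.lookup (f * g) (a + b) = Poly_Mapping.lookup f a * Poly_Mapping.lookup g b"
proof -
  have "Poly_Mapping.lookup f l * (\<Sum>q. (Poly_Mapping.lookup g q when a + b = l + q)) =
      (Poly_Mapping.lookup f a * Poly_Mapping.lookup g b when l = a)" for l
  proof (cases "l \<in> Poly_Mapping.keys f")
    case True
    \<comment> \<open>Nesting the two conditions lets the sum over \<open>q\<close> be evaluated at
      \<open>b\<close>.\<close>
    have "(Poly_Mapping.lookup g q when a + b = l + q) =
        ((Poly_Mapping.lookup g q when l = a) when q = b)" for q
    proof (cases "q \<in> Poly_Mapping.keys g")
      case q: True
      have "a + b = l + q \<longleftrightarrow> l = a \<and> q = b" using assms[OF True q] by blast
      then show ?thesis by (simp add: when_def)
    qed (simp add: in_keys_iff when_def)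
    then show ?thesis by (simp add: Sum_any_when_equal when_def)
  qed (auto simp: in_keys_iff when_def)
  then show ?thesis by (simp add: lookup_mult)
qed

lemma argmin_face:
  fixes A :: "'m set" and \<phi> :: "'m \<Rightarrow> nat"
  assumes "A \<noteq> {}"
  shows "{a \<in> A. \<forall>a'\<in>A. \<phi> a \<le> \<phi> a'} \<noteq> {}"
proof -
  obtain a where "a \<in> A" using assms by blast
  then show ?thesis using ex_has_least_nat[of "\<lambda>a. a \<in> A" a \<phi>] by auto
qed

text \<open>Taking the faces of \<open>A\<close> and \<open>B\<close> on which a linear functional is minimal, one functional after
  the other, keeps all decompositions of sums of face elements inside the faces.\<close>

lemma common_faces:
  fixes A B :: "'m::comm_monoid_add set" and \<phi> :: "'i \<Rightarrow> 'm \<Rightarrow> nat"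
  assumes "finite F" and "A \<noteq> {}" "B \<noteq> {}"
    and "\<And>i a b. i \<in> F \<Longrightarrow> \<phi> i (a + b) = \<phi> i a + \<phi> i b"
  shows "\<exists>A' B'. A' \<subseteq> A \<and> B' \<subseteq> B \<and> A' \<noteq> {} \<and> B' \<noteq> {} \<and>
    (\<forall>i\<in>F. \<forall>a\<in>A'. \<forall>a'\<in>A'. \<phi> i a = \<phi> i a') \<and> (\<forall>i\<in>F. \<forall>b\<in>B'. \<forall>b'\<in>B'. \<phi> i b = \<phi> i b') \<and>
    (\<forall>a\<in>A. \<forall>b\<in>B. \<forall>a'\<in>A'. \<forall>b'\<in>B'. a' + b' = a + b \<longrightarrow> a \<in> A' \<and> b \<in> B')"
  using assms(1,4)
proof (induction F rule: finite_induct)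
  case empty
  then show ?case using assms(2,3) by blast
next
  case (insert i F)
  have "\<exists>A' B'. A' \<subseteq> A \<and> B' \<subseteq> B \<and> A' \<noteq> {} \<and> B' \<noteq> {} \<and>
    (\<forall>i\<in>F. \<forall>a\<in>A'. \<forall>a'\<in>A'. \<phi> i a = \<phi> i a') \<and> (\<forall>i\<in>F. \<forall>b\<in>B'. \<forall>b'\<in>B'. \<phi> i b = \<phi> i b') \<and>
    (\<forall>a\<in>A. \<forall>b\<in>B. \<forall>a'\<in>A'. \<forall>b'\<in>B'. a' + b' = a + b \<longrightarrow> a \<in> A' \<and> b \<in> B')"
    by (rule insert.IH) (simp add: insert.prems)
  then obtain A' B' where AB: "A' \<subseteq> A" "B' \<subseteq> B" "A' \<noteq> {}" "B' \<noteq> {}"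
    and const: "\<forall>i\<in>F. \<forall>a\<in>A'. \<forall>a'\<in>A'. \<phi> i a = \<phi> i a'" "\<forall>i\<in>F. \<forall>b\<in>B'. \<forall>b'\<in>B'. \<phi> i b = \<phi> i b'"
    and face: "\<forall>a\<in>A. \<forall>b\<in>B. \<forall>a'\<in>A'. \<forall>b'\<in>B'. a' + b' = a + b \<longrightarrow> a \<in> A' \<and> b \<in> B'"
    by (elim exE conjE) (rule that; assumption)
  define A'' where "A'' = {a \<in> A'. \<forall>a'\<in>A'. \<phi> i a \<le> \<phi> i a'}"
  define B'' where "B'' = {b \<in> B'. \<forall>b'\<in>B'. \<phi> i b \<le> \<phi> i b'}"
  have face'': "a \<in> A'' \<and> b \<in> B''"
    if "a \<in> A" "b \<in> B" "a' \<in> A''" "b' \<in> B''" "a' + b' = a + b" for a b a' b'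
  proof -
    have ab: "a \<in> A'" "b \<in> B'" and ab': "a' \<in> A'" "b' \<in> B'"
      using face[rule_format, of a b a' b'] that by (auto simp: A''_def B''_def)
    then have le: "\<phi> i a' \<le> \<phi> i a" "\<phi> i b' \<le> \<phi> i b" using that by (auto simp: A''_def B''_def)
    have "\<phi> i a' + \<phi> i b' = \<phi> i a + \<phi> i b"
      using insert.prems[of i a b] insert.prems[of i a' b'] that(5) by simp
    with le have "\<phi> i a = \<phi> i a'" "\<phi> i b = \<phi> i b'" by linarith+
    then show ?thesis using ab that(3,4) by (simp add: A''_def B''_def)
  qed
  show ?case
  proof (intro exI conjI)
    show "A'' \<noteq> {}" "B'' \<noteq> {}"
      unfolding A''_def B''_def using AB by (simp_all only: argmin_face not_False_eq_True)
    show "\<forall>a\<in>A. \<forall>b\<in>B. \<forall>a'\<in>A''. \<forall>b'\<in>B''. a' + b' = a + b \<longrightarrow> a \<in> A'' \<and> b \<in> B''"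
      using face'' by blast
  qed (use AB const in \<open>auto simp: A''_def B''_def intro: antisym\<close>)
qed

text \<open>Lowest forms multiply to something nonzero. Among the terms of least
  \<open>w\<close>-weight, minimising every coordinate in turn leaves one exponent in each factor,
  and the sum of these two splits in only one way.\<close>

lemma keys_mult_minimal:
  fixes f g :: "('v::finite \<Rightarrow>\<^sub>0 nat) \<Rightarrow>\<^sub>0 'k::field"
  assumes "f \<noteq> 0" "g \<noteq> 0"
  obtains a b where "a \<in> Poly_Mapping.keys f" "b \<in> Poly_Mapping.keys g" "a + b \<in> Poly_Mapping.keys (f * g)"
    "\<And>a'. a' \<in> Poly_Mapping.keys f \<Longrightarrow> wdeg w a \<le> wdeg w a'"
    "\<And>b'. b' \<in> Poly_Mapping.keys g \<Longrightarrow> wdeg w b \<le> wdeg w b'"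
proof -
  let ?A = "Poly_Mapping.keys f" and ?B = "Poly_Mapping.keys g"
  define A0 where "A0 = {a \<in> ?A. \<forall>a'\<in>?A. wdeg w a \<le> wdeg w a'}"
  define B0 where "B0 = {b \<in> ?B. \<forall>b'\<in>?B. wdeg w b \<le> wdeg w b'}"
  have ne: "A0 \<noteq> {}" "B0 \<noteq> {}"
    unfolding A0_def B0_def using assms by (simp_all only: argmin_face keys_eq_empty not_False_eq_True)
  obtain A' B' where AB: "A' \<subseteq> A0" "B' \<subseteq> B0" "A' \<noteq> {}" "B' \<noteq> {}"
    and const: "\<forall>v\<in>UNIV. \<forall>a\<in>A'. \<forall>a'\<in>A'. Poly_Mapping.lookup a v = Poly_Mapping.lookup a' v"
      "\<forall>v\<in>UNIV. \<forall>b\<in>B'. \<forall>b'\<in>B'. Poly_Mapping.lookup b v = Poly_Mapping.lookup b' v"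
    and face: "\<forall>a\<in>A0. \<forall>b\<in>B0. \<forall>a'\<in>A'. \<forall>b'\<in>B'. a' + b' = a + b \<longrightarrow> a \<in> A' \<and> b \<in> B'"
    using common_faces[of UNIV A0 B0 "\<lambda>v m. Poly_Mapping.lookup m v", OF finite ne lookup_add]
    by (elim exE conjE) (rule that; assumption)
  then obtain a b where ab: "a \<in> A'" "b \<in> B'" by blast
  have "l = a \<and> q = b" if "l \<in> ?A" "q \<in> ?B" "a + b = l + q" for l q
  proof -
    have a0: "a \<in> A0" "b \<in> B0" using ab AB by blast+
    have "wdeg w a \<le> wdeg w l" "wdeg w b \<le> wdeg w q" using a0 that by (auto simp: A0_def B0_def)
    moreover have "wdeg w a + wdeg w b = wdeg w l + wdeg w q" using that(3) by (metis wdeg_add)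
    ultimately have "wdeg w a = wdeg w l" "wdeg w b = wdeg w q" by linarith+
    then have "l \<in> A0" "q \<in> B0" using a0 that by (auto simp: A0_def B0_def)
    then have "l \<in> A'" "q \<in> B'" using face ab that(3) by blast+
    then have "Poly_Mapping.lookup l v = Poly_Mapping.lookup a v"
      "Poly_Mapping.lookup q v = Poly_Mapping.lookup b v" for v
      using const ab by blast+
    then show ?thesis by (simp add: poly_mapping_eqI)
  qed
  then have "Poly_Mapping.lookup (f * g) (a + b) = Poly_Mapping.lookup f a * Poly_Mapping.lookup g b"
    by (rule lookup_mult_unique)
  moreover have "a \<in> A0" "b \<in> B0" using ab AB by blast+
  ultimately show thesis
    by (intro that[of a b]) (auto simp: A0_def B0_def in_keys_iff)
qed

lemma add_mem_keys_mult_single: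
  fixes f :: "('v \<Rightarrow>\<^sub>0 nat) \<Rightarrow>\<^sub>0 'k::field"
  assumes "a \<in> Poly_Mapping.keys f"
  shows "a + m \<in> Poly_Mapping.keys (f * Poly_Mapping.single m 1)"
proof -
  have "Poly_Mapping.lookup (f * Poly_Mapping.single m 1) (a + m) =
      Poly_Mapping.lookup f a * Poly_Mapping.lookup (Poly_Mapping.single m 1) m"
    by (rule lookup_mult_unique) simp
  then show ?thesis using assms by (simp add: in_keys_iff)
qed

section \<open>Vertex covers and products of edges\<close>

definition edge_monos :: "'v set set \<Rightarrow> ('v \<Rightarrow>\<^sub>0 nat) set" where
  "edge_monos E = sumset {unit_exp u + unit_exp v | u v. {u, v} \<in> E} UNIV"

definition vertex_cover :: "'v set set \<Rightarrow> 'v set \<Rightarrow> bool" where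
  "vertex_cover E W \<longleftrightarrow> (\<forall>u v. {u, v} \<in> E \<longrightarrow> u \<in> W \<or> v \<in> W)"

lemma vertex_coverD: "vertex_cover E W \<Longrightarrow> {u, v} \<in> E \<Longrightarrow> u \<in> W \<or> v \<in> W"
  by (simp add: vertex_cover_def)

lemma simple_graph_neq: "simple_graph E \<Longrightarrow> {u, v} \<in> E \<Longrightarrow> u \<noteq> v"
  by (force simp: simple_graph_def)

lemma up_closed_edge_monos: "up_closed (edge_monos E)"
  unfolding edge_monos_def by (rule up_closed_sumset) (simp add: up_closed_def)

lemma edge_in_edge_monos: "{u, v} \<in> E \<Longrightarrow> unit_exp u + unit_exp v \<in> edge_monos E"
  unfolding edge_monos_def sumset_def by (intro CollectI exI[of _ 0] exI conjI) (rule add_0_right[symmetric], blast+)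

lemma add_edge_sumset_pow:
  "m \<in> sumset_pow (edge_monos E) s \<Longrightarrow> {u, v} \<in> E \<Longrightarrow>
    m + (unit_exp u + unit_exp v) \<in> sumset_pow (edge_monos E) (Suc s)"
  unfolding sumset_pow.simps by (intro sumsetI edge_in_edge_monos)

lemma split_edge:
  assumes "u \<noteq> v" "Poly_Mapping.lookup m u > 0" "Poly_Mapping.lookup m v > 0"
  shows "m - (unit_exp u + unit_exp v) + (unit_exp u + unit_exp v) = m"
  using assms by (intro poly_mapping_eqI) (auto simp: lookup_add lookup_minus lookup_single when_def)

text \<open>The ends of an edge differ, so positive exponents at both ends suffice; a loop would
  demand exponent 2.\<close>

lemma edge_monos_iff:
  assumes "simple_graph E"
  shows "m \<in> edge_monos E \<longleftrightarrow>
    (\<exists>u v. {u, v} \<in> E \<and> Poly_Mapping.lookup m u > 0 \<and> Poly_Mapping.lookup m v > 0)"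
proof
  assume "\<exists>u v. {u, v} \<in> E \<and> Poly_Mapping.lookup m u > 0 \<and> Poly_Mapping.lookup m v > 0"
  then obtain u v where uv: "{u, v} \<in> E" "Poly_Mapping.lookup m u > 0" "Poly_Mapping.lookup m v > 0"
    by blast
  then have "(unit_exp u + unit_exp v) + (m - (unit_exp u + unit_exp v)) = m"
    using split_edge[of u v m] simple_graph_neq[OF assms] by (metis add.commute)
  then show "m \<in> edge_monos E"
    using edge_in_edge_monos[OF uv(1)] up_closed_edge_monos[of E] unfolding up_closed_def by metis
next
  assume "m \<in> edge_monos E"
  then obtain u v b where "m = unit_exp u + unit_exp v + b" "{u, v} \<in> E"
    by (auto simp: edge_monos_def sumset_def)
  then show "\<exists>u v. {u, v} \<in> E \<and> Poly_Mapping.lookup m u > 0 \<and> Poly_Mapping.lookup m v > 0"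
    by (intro exI[of _ u] exI[of _ v]) (simp add: lookup_add)
qed

text \<open>Trades truncated subtraction for a sum and records the effect on exponents and on cover
  weights, as both inductions on \<open>s\<close> below require.\<close>

lemma remove_edge:
  assumes "u \<noteq> v" "Poly_Mapping.lookup m u > 0" "Poly_Mapping.lookup m v > 0"
  obtains m' where "m = m' + (unit_exp u + unit_exp v)"
    "\<And>x. Poly_Mapping.lookup m x = Poly_Mapping.lookup m' x + of_bool (x = u) + of_bool (x = v)"
    "\<And>W. sum (Poly_Mapping.lookup m) (W::'v::finite set) =
      sum (Poly_Mapping.lookup m') W + of_bool (u \<in> W) + of_bool (v \<in> W)"
proof -
  define m' where "m' = m - (unit_exp u + unit_exp v)"
  have m: "m = m' + (unit_exp u + unit_exp v)"
    using split_edge[OF assms] by (simp add: m'_def)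
  show thesis
  proof (rule that[OF m])
    show "Poly_Mapping.lookup m x = Poly_Mapping.lookup m' x + of_bool (x = u) + of_bool (x = v)" for x
      by (subst m) (simp add: lookup_add lookup_single when_def)
    show "sum (Poly_Mapping.lookup m) W =
        sum (Poly_Mapping.lookup m') W + of_bool (u \<in> W) + of_bool (v \<in> W)" for W
      by (subst m) (simp only: wdeg_of_bool[symmetric] wdeg_add wdeg_single mult_1_right add.assoc)
  qed
qed

section \<open>Forests, Koenig duality and greedy matching\<close>

definition is_path :: "'v set set \<Rightarrow> 'v list \<Rightarrow> bool" where
  "is_path E xs \<longleftrightarrow> distinct xs \<and> (\<forall>i. Suc i < length xs \<longrightarrow> {xs ! i, xs ! Suc i} \<in> E)"

lemma path_closes_to_cycle:
  assumes "is_path E xs" "j < length xs" "j \<ge> 2" "{xs ! j, xs ! 0} \<in> E"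
  shows "is_cycle E (take (Suc j) xs)"
proof -
  have len: "length (take (Suc j) xs) = Suc j" using assms(2) by simp
  have "cycle_edges (take (Suc j) xs) \<subseteq> E"
  proof
    fix e assume "e \<in> cycle_edges (take (Suc j) xs)"
    then obtain i where i: "i < Suc j"
      "e = {take (Suc j) xs ! i, take (Suc j) xs ! (Suc i mod Suc j)}"
      unfolding cycle_edges_def len by blast
    show "e \<in> E"
    proof (cases "i = j")
      case True
      then show ?thesis using i assms(4) by simp
    next
      case False
      then show ?thesis using i assms(1,2) by (simp add: is_path_def)
    qed
  qed
  then show ?thesis using assms len by (simp add: is_cycle_def is_path_def)
qed

text \<open>The first vertex of a longest path inside \<open>S\<close> is a leaf: a second neighbour
  in \<open>S\<close> would either prolong the path or close a cycle inside
  \<open>S\<close>.\<close>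

lemma forest_leaf:
  fixes E :: "'v::finite set set"
  assumes E: "simple_graph E" and acyclic: "\<And>xs. is_cycle E xs \<Longrightarrow> \<not> set xs \<subseteq> S"
    and edge: "{u, v} \<in> E" "u \<in> S" "v \<in> S"
  obtains z y where "z \<in> S" "y \<in> S" "{z, y} \<in> E" "\<And>x. x \<in> S \<Longrightarrow> {z, x} \<in> E \<Longrightarrow> x = y"
proof -
  let ?P = "\<lambda>xs. is_path E xs \<and> set xs \<subseteq> S"
  have "?P [u, v]" using edge simple_graph_neq[OF E edge(1)] by (auto simp: is_path_def)
  moreover have "length xs < Suc (card (UNIV :: 'v set))" if "?P xs" for xs
    using that distinct_card[of xs] card_mono[of UNIV "set xs"] by (simp add: is_path_def)
  ultimately obtain xs where xs: "?P xs" and longest: "\<And>ys. ?P ys \<Longrightarrow> length ys \<le> length xs"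
    using ex_has_greatest_nat[of ?P "[u, v]" length "Suc (card (UNIV :: 'v set))"] by blast
  have "length xs \<ge> 2" using longest[OF \<open>?P [u, v]\<close>] by simp
  then obtain a b r where abr: "xs = a # b # r" by (cases xs rule: list.exhaust; cases "tl xs") auto
  have ab: "{a, b} \<in> E" using xs by (auto simp: abr is_path_def)
  have leaf: "x = b" if x: "x \<in> S" "{a, x} \<in> E" for x
  proof (rule ccontr)
    assume "x \<noteq> b"
    have "x \<noteq> a" using simple_graph_neq[OF E x(2)] by simp
    show False
    proof (cases "x \<in> set xs")
      case True
      then obtain j where j: "j < length xs" "xs ! j = x" by (auto simp: in_set_conv_nth)
      have "xs ! 0 = a" "xs ! 1 = b" by (simp_all add: abr)
      then have "j \<noteq> 0" "j \<noteq> 1" using j \<open>x \<noteq> a\<close> \<open>x \<noteq> b\<close> by metis+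
      then have "is_cycle E (take (Suc j) xs)"
        using j xs x(2) by (intro path_closes_to_cycle) (auto simp: abr insert_commute)
      then show False using acyclic xs set_take_subset[of "Suc j" xs] by blast
    next
      case False
      then have "?P (x # xs)" using xs x by (auto simp: is_path_def nth_Cons abr insert_commute split: nat.split)
      then show False using longest[of "x # xs"] by simp
    qed
  qed
  have "a \<in> S" "b \<in> S" using xs by (auto simp: abr)
  then show thesis using ab leaf by (rule that)
qed

text \<open>Koenig's theorem for weighted forests: an edge at a leaf of the support can always be
  removed, since a cover containing both of its ends can be traded for one without the leaf.\<close>

lemma forest_product_of_edges:
  fixes E :: "'v::finite set set"
  assumes E: "simple_graph E"
    and acyclic: "\<And>xs. is_cycle E xs \<Longrightarrow> \<exists>x\<in>set xs. Poly_Mapping.lookup m x = 0"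
    and covers: "\<And>W. vertex_cover E W \<Longrightarrow> s \<le> sum (Poly_Mapping.lookup m) W"
  shows "m \<in> sumset_pow (edge_monos E) s"
  using acyclic covers
proof (induction s arbitrary: m)
  case (Suc s)
  define S where "S = {x. Poly_Mapping.lookup m x > 0}"
  \<comment> \<open>The complement of the support has weight 0, too little for a cover, so some edge
    lies inside the support.\<close>
  have "\<not> vertex_cover E (- S)" using Suc.prems(2)[of "- S"] by (auto simp: S_def)
  then obtain u v where "{u, v} \<in> E" "u \<in> S" "v \<in> S" by (auto simp: vertex_cover_def)
  moreover have "\<not> set xs \<subseteq> S" if "is_cycle E xs" for xs
    using Suc.prems(1)[OF that] by (auto simp: S_def)
  ultimately obtain z y where zy: "z \<in> S" "y \<in> S" "{z, y} \<in> E"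
    and leaf: "\<And>x. x \<in> S \<Longrightarrow> {z, x} \<in> E \<Longrightarrow> x = y"
    using forest_leaf[OF E] by metis
  have "z \<noteq> y" using simple_graph_neq[OF E zy(3)] .
  then obtain m' where m: "m = m' + (unit_exp z + unit_exp y)"
    and lookup: "\<And>x. Poly_Mapping.lookup m x =
      Poly_Mapping.lookup m' x + of_bool (x = z) + of_bool (x = y)"
    and sum: "\<And>W. sum (Poly_Mapping.lookup m) W =
      sum (Poly_Mapping.lookup m') W + of_bool (z \<in> W) + of_bool (y \<in> W)"
    using remove_edge[of z y m] zy(1,2) by (auto simp: S_def)
  have "m' \<in> sumset_pow (edge_monos E) s"
  proof (rule Suc.IH)
    fix xs assume "is_cycle E xs"
    then obtain x where "x \<in> set xs" "Poly_Mapping.lookup m x = 0" using Suc.prems(1) by blast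
    then show "\<exists>x\<in>set xs. Poly_Mapping.lookup m' x = 0" using lookup[of x] by auto
  next
    fix W assume W: "vertex_cover E W"
    show "s \<le> sum (Poly_Mapping.lookup m') W"
    proof (cases "z \<in> W \<and> y \<in> W")
      case True
      \<comment> \<open>Dropping \<open>z\<close> uncovers only edges at \<open>z\<close>. Their
        other ends are \<open>y\<close>, which is in \<open>W\<close>, or lie outside the support
        and can be added at no weight.\<close>
      have "vertex_cover E ((W - {z}) \<union> - S)"
        unfolding vertex_cover_def
      proof (intro allI impI)
        fix a b assume ab: "{a, b} \<in> E"
        then have "{b, a} \<in> E" by (simp add: insert_commute)
        then show "a \<in> (W - {z}) \<union> - S \<or> b \<in> (W - {z}) \<union> - S"
          using vertex_coverD[OF W ab] leaf[of a] leaf[of b] ab True \<open>z \<noteq> y\<close> by blast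
      qed
      then have "Suc s \<le> sum (Poly_Mapping.lookup m) ((W - {z}) \<union> - S)" by (rule Suc.prems(2))
      also have "\<dots> = sum (Poly_Mapping.lookup m) (W - {z})"
        by (rule sum.mono_neutral_right) (auto simp: S_def)
      finally have "Suc s + Poly_Mapping.lookup m z \<le> sum (Poly_Mapping.lookup m) W"
        using True by (simp add: sum.remove[of W z])
      then show ?thesis using sum[of W] True zy(1) by (simp add: S_def)
    next
      case False
      then show ?thesis using Suc.prems(2)[OF W] sum[of W] by (auto simp: of_bool_def split: if_splits)
    qed
  qed
  then show ?case unfolding m using zy(3) by (rule add_edge_sumset_pow)
qed simp

text \<open>A vertex of large weight can be matched greedily with its neighbours; once they are exhausted,
  the support avoids the neighbours and is therefore acyclic.\<close>

lemma heavy_vertex_product_of_edges: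
  fixes E :: "'v::finite set set"
  assumes E: "simple_graph E" and cycles: "\<And>xs. is_cycle E xs \<Longrightarrow> \<exists>x\<in>set xs. {v, x} \<in> E"
    and heavy: "s \<le> Poly_Mapping.lookup m v"
    and covers: "\<And>W. vertex_cover E W \<Longrightarrow> s \<le> sum (Poly_Mapping.lookup m) W"
  shows "m \<in> sumset_pow (edge_monos E) s"
  using heavy covers
proof (induction s arbitrary: m)
  case (Suc s)
  show ?case
  proof (cases "\<exists>y. {v, y} \<in> E \<and> Poly_Mapping.lookup m y > 0")
    case True
    then obtain y where y: "{v, y} \<in> E" "Poly_Mapping.lookup m y > 0" by blast
    have "v \<noteq> y" using simple_graph_neq[OF E y(1)] .
    then obtain m' where m: "m = m' + (unit_exp v + unit_exp y)"
      and lookup: "\<And>x. Poly_Mapping.lookup m x =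
        Poly_Mapping.lookup m' x + of_bool (x = v) + of_bool (x = y)"
      and sum: "\<And>W. sum (Poly_Mapping.lookup m) W =
        sum (Poly_Mapping.lookup m') W + of_bool (v \<in> W) + of_bool (y \<in> W)"
      using remove_edge[of v y m] y(2) Suc.prems(1) by auto
    have v: "s \<le> Poly_Mapping.lookup m' v" using lookup[of v] Suc.prems(1) \<open>v \<noteq> y\<close> by simp
    have "m' \<in> sumset_pow (edge_monos E) s"
    proof (rule Suc.IH[OF v])
      fix W assume W: "vertex_cover E W"
      show "s \<le> sum (Poly_Mapping.lookup m') W"
      \<comment> \<open>A cover with \<open>v\<close> may lose two units, but the remaining weight
        of \<open>v\<close> alone suffices. Any other cover loses at most one.\<close>
      proof (cases "v \<in> W")
        case True
        then show ?thesis using v member_le_sum[of v W "Poly_Mapping.lookup m'"] by simp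
      next
        case False
        then show ?thesis using Suc.prems(2)[OF W] sum[of W] by (auto simp: of_bool_def split: if_splits)
      qed
    qed
    then show ?thesis unfolding m using y(1) by (rule add_edge_sumset_pow)
  next
    case False
    show ?thesis
    \<comment> \<open>Every cycle meets the neighbours of \<open>v\<close>, which now all have
      exponent 0.\<close>
    proof (rule forest_product_of_edges[OF E _ Suc.prems(2)])
      fix xs assume "is_cycle E xs"
      then show "\<exists>x\<in>set xs. Poly_Mapping.lookup m x = 0" using cycles[of xs] False by fastforce
    qed
  qed
qed simp

section \<open>Cycles\<close>

lemma cycle_edge:
  assumes "is_cycle E xs" "i < length xs"
  shows "{xs ! i, xs ! (Suc i mod length xs)} \<in> E"
  using assms by (auto simp: is_cycle_def cycle_edges_def)

lemma Union_cycle_edges: "\<Union> (cycle_edges xs) = set xs"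
proof -
  have "Suc i mod length xs < length xs" if "i < length xs" for i
    using that by (metis gr_implies_not0 mod_less_divisor not_gr_zero)
  then show ?thesis by (auto simp: cycle_edges_def in_set_conv_nth) blast+
qed

text \<open>Uniqueness in \<open>unicyclic\<close> is about edge sets; their union recovers the
  vertices.\<close>

lemma unicyclic_cycle_set_eq:
  "unicyclic E \<Longrightarrow> is_cycle E xs \<Longrightarrow> is_cycle E ys \<Longrightarrow> set xs = set ys"
  unfolding unicyclic_def by (subst (1 2) Union_cycle_edges[symmetric], rule arg_cong[of _ _ Union]) blast

text \<open>A vertex on the cycle is adjacent to its successor, so even these vertices have a
  neighbour on the cycle.\<close>

lemma closed_nbhd_cycle_neighbour:
  assumes "is_cycle E xs" "v \<in> closed_nbhd E (set xs)"
  shows "\<exists>x\<in>set xs. {v, x} \<in> E"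
proof (cases "v \<in> set xs")
  case True
  then obtain i where i: "i < length xs" "v = xs ! i" by (auto simp: in_set_conv_nth)
  then have "{v, xs ! (Suc i mod length xs)} \<in> E" using cycle_edge[OF assms(1)] by simp
  moreover have "Suc i mod length xs < length xs" using i by (intro mod_less_divisor) auto
  ultimately show ?thesis by (meson nth_mem)
qed (use assms in \<open>auto simp: closed_nbhd_def\<close>)

text \<open>Double counting: each of the \<open>2 * n + 1\<close> edges has an end in
  \<open>W\<close>, and each vertex lies on two of them. Halving and rounding up gives
  \<open>n + 1\<close>.\<close>

lemma odd_cycle_cover:
  assumes cycle: "is_cycle E xs" and len: "length xs = 2 * n + 1" and W: "vertex_cover E W"
  shows "n + 1 \<le> (\<Sum>x\<in>set xs. of_bool (x \<in> W))"
proof -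
  define f :: "nat \<Rightarrow> nat" where "f i = of_bool (xs ! i \<in> W)" for i
  \<comment> \<open>Taking successors permutes the positions: the last one wraps around to
    0.\<close>
  have "(\<Sum>i<2 * n + 1. f (Suc i mod (2 * n + 1))) = (\<Sum>i<2 * n. f (Suc i)) + f 0"
    by simp
  also have "\<dots> = (\<Sum>i<2 * n + 1. f i)"
    by (simp only: Suc_eq_plus1[symmetric] sum.lessThan_Suc_shift add.commute[of _ "f 0"])
  finally have shift: "(\<Sum>i<2 * n + 1. f (Suc i mod (2 * n + 1))) = (\<Sum>i<2 * n + 1. f i)" .
  have "1 \<le> f i + f (Suc i mod (2 * n + 1))" if "i < 2 * n + 1" for i
    using vertex_coverD[OF W cycle_edge[OF cycle, of i]] that len by (auto simp: f_def)
  then have "(\<Sum>i<2 * n + 1. 1) \<le> (\<Sum>i<2 * n + 1. f i + f (Suc i mod (2 * n + 1)))"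
    by (intro sum_mono) simp
  then have "2 * n + 1 \<le> 2 * (\<Sum>i<2 * n + 1. f i)"
    unfolding sum.distrib shift by simp
  moreover have "(\<Sum>x\<in>set xs. of_bool (x \<in> W)) = (\<Sum>i<2 * n + 1. f i)"
  proof -
    have "bij_betw ((!) xs) {..<2 * n + 1} (set xs)"
      using cycle len by (intro bij_betw_nth) (auto simp: is_cycle_def)
    then show ?thesis unfolding f_def by (rule sum.reindex_bij_betw[symmetric])
  qed
  ultimately show ?thesis by simp
qed

section \<open>Symbolic powers of edge ideals\<close>

lemma edge_ideal_eq_mono_ideal:
  "(edge_ideal E :: ('v, 'k::field) polynomials set) = mono_ideal (edge_monos E)"
proof -
  have "{var u * var v | u v. {u, v} \<in> E} =
      ((\<lambda>a. Poly_Mapping.single a 1) ` {unit_exp u + unit_exp v | u v. {u, v} \<in> E} ::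
        ('v, 'k) polynomials set)"
    by (auto simp: var_def mult_single image_iff)
  then show ?thesis
    unfolding edge_ideal_def edge_monos_def by (simp only: genideal_monomials)
qed

lemma max_ideal_eq_mono_ideal:
  "(max_ideal :: ('v, 'k::field) polynomials set) = mono_ideal (sumset (range unit_exp) UNIV)"
proof -
  have "range var = ((\<lambda>a. Poly_Mapping.single a 1) ` range unit_exp :: ('v, 'k) polynomials set)"
    by (auto simp: var_def image_iff)
  then show ?thesis unfolding max_ideal_def by (simp only: genideal_monomials)
qed

lemma wdeg_edge_monos:
  assumes "m \<in> edge_monos E" and w: "\<And>u v. {u, v} \<in> E \<Longrightarrow> c \<le> w u + w v"
  shows "c \<le> wdeg w m"
proof -
  obtain u v b where m: "m = unit_exp u + unit_exp v + b" and uv: "{u, v} \<in> E"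
    using assms(1) by (auto simp: edge_monos_def sumset_def)
  show ?thesis using w[OF uv] by (simp add: m wdeg_add)
qed

lemma ideal_power_edge_ideal:
  "ideal_power vertex_ring (edge_ideal E) k = mono_ideal (sumset_pow (edge_monos E) k)"
  unfolding edge_ideal_eq_mono_ideal by (rule ideal_power_mono_ideal[OF up_closed_edge_monos])

lemma ideal_ideal_power_edge_ideal: "ideal (ideal_power vertex_ring (edge_ideal E) k) vertex_ring"
  unfolding ideal_power_edge_ideal
  by (intro ideal_mono_ideal up_closed_sumset_pow up_closed_edge_monos)

section \<open>Associated primes and vertex covers\<close>

text \<open>This is the ideal generated by the variables of positive weight. If both factors had a
  term of weight 0, their lowest forms would leave such a term in the product.\<close>

lemma primeideal_wdeg_pos:
  "primeideal (mono_ideal {m. wdeg w m > 0} :: ('v::finite, 'k::field) polynomials set) vertex_ring"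
proof (rule primeidealI)
  show "ideal (mono_ideal {m. wdeg w m > 0} :: ('v, 'k) polynomials set) vertex_ring"
    by (rule ideal_mono_ideal) (simp add: up_closed_def wdeg_add)
  show "cring (vertex_ring :: ('v, 'k) polynomials ring)" ..
  have "(1 :: ('v, 'k) polynomials) \<notin> mono_ideal {m. wdeg w m > 0}"
    by (simp add: mono_ideal_def)
  then show "carrier vertex_ring \<noteq> (mono_ideal {m. wdeg w m > 0} :: ('v, 'k) polynomials set)"
    by auto
  fix f g :: "('v, 'k) polynomials"
  assume fg: "f \<otimes>\<^bsub>vertex_ring\<^esub> g \<in> mono_ideal {m. wdeg w m > 0}"
  show "f \<in> mono_ideal {m. wdeg w m > 0} \<or> g \<in> mono_ideal {m. wdeg w m > 0}"
  proof (rule ccontr)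
    assume neg: "\<not> ?thesis"
    then obtain a0 b0 where 0: "a0 \<in> Poly_Mapping.keys f" "wdeg w a0 = 0" "b0 \<in> Poly_Mapping.keys g" "wdeg w b0 = 0"
      by (auto simp: mono_ideal_def)
    then have "f \<noteq> 0" "g \<noteq> 0" by auto
    then obtain a b where "a + b \<in> Poly_Mapping.keys (f * g)"
      and "wdeg w a \<le> wdeg w a0" "wdeg w b \<le> wdeg w b0"
      using keys_mult_minimal[of f g w] 0(1,3) by metis
    then have "wdeg w (a + b) > 0" "wdeg w (a + b) = 0"
      using fg 0 by (auto simp: mono_ideal_def wdeg_add)
    then show False by simp
  qed
qed

text \<open>The prime annihilates the class of the product \<open>m0\<close> of all variables
  outside \<open>W\<close>. These vertices are independent, so \<open>m0\<close> times a monomial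
  contains an edge only if the monomial involves \<open>W\<close>; it then does so through a
  neighbour outside \<open>W\<close>.\<close>

lemma cover_prime_associated:
  fixes E :: "'v::finite set set"
  assumes E: "simple_graph E" and W: "vertex_cover E W"
    and minimal: "\<And>v. v \<in> W \<Longrightarrow> \<exists>u. u \<notin> W \<and> {u, v} \<in> E"
  shows "(mono_ideal {m. wdeg (\<lambda>v. of_bool (v \<in> W)) m > 0} :: ('v, 'k::field) polynomials set)
    \<in> associated_primes vertex_ring (edge_ideal E)" (is "?p \<in> _")
proof -
  define m0 :: "'v \<Rightarrow>\<^sub>0 nat" where "m0 = (\<Sum>v\<in>- W. unit_exp v)"
  have m0: "Poly_Mapping.lookup m0 v = of_bool (v \<notin> W)" for v
    by (simp add: m0_def lookup_sum lookup_single when_def)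
  have key: "wdeg (\<lambda>v. of_bool (v \<in> W)) a > 0 \<longleftrightarrow> a + m0 \<in> edge_monos E" for a
  proof -
    have "wdeg (\<lambda>v. of_bool (v \<in> W)) a > 0 \<longleftrightarrow> (\<exists>v\<in>W. Poly_Mapping.lookup a v > 0)"
      unfolding wdeg_of_bool neq0_conv[symmetric] by (simp only: sum_eq_0_iff finite) simp
    also have "\<dots> \<longleftrightarrow> a + m0 \<in> edge_monos E"
      unfolding edge_monos_iff[OF E] lookup_add m0
    proof
      assume "\<exists>v\<in>W. Poly_Mapping.lookup a v > 0"
      then obtain u v where "v \<in> W" "Poly_Mapping.lookup a v > 0" "u \<notin> W" "{u, v} \<in> E"
        using minimal by blast
      then show "\<exists>u v. {u, v} \<in> E \<and> Poly_Mapping.lookup a u + of_bool (u \<notin> W) > 0 \<and>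
          Poly_Mapping.lookup a v + of_bool (v \<notin> W) > 0"
        by (intro exI[of _ u] exI[of _ v]) simp
    next
      assume "\<exists>u v. {u, v} \<in> E \<and> Poly_Mapping.lookup a u + of_bool (u \<notin> W) > 0 \<and>
          Poly_Mapping.lookup a v + of_bool (v \<notin> W) > 0"
      then obtain u v where *: "{u, v} \<in> E" "Poly_Mapping.lookup a u + of_bool (u \<notin> W) > 0"
          "Poly_Mapping.lookup a v + of_bool (v \<notin> W) > 0" by (elim exE conjE)
      then show "\<exists>v\<in>W. Poly_Mapping.lookup a v > 0"
        using vertex_coverD[OF W *(1)] by auto
    qed
    finally show ?thesis .
  qed
  have "?p = {r \<in> carrier vertex_ring. r \<otimes>\<^bsub>vertex_ring\<^esub> Poly_Mapping.single m0 1 \<in> edge_ideal E}"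
  proof (intro equalityI subsetI)
    fix r :: "('v, 'k) polynomials" assume "r \<in> ?p"
    moreover have "Poly_Mapping.keys (r * Poly_Mapping.single m0 1) \<subseteq> (\<lambda>a. a + m0) ` Poly_Mapping.keys r"
      using keys_mult[of r "Poly_Mapping.single m0 1"] by auto
    ultimately have "Poly_Mapping.keys (r * Poly_Mapping.single m0 1) \<subseteq> edge_monos E"
      using key by (auto simp only: mono_ideal_def)
    then show "r \<in> {r \<in> carrier vertex_ring. r \<otimes>\<^bsub>vertex_ring\<^esub> Poly_Mapping.single m0 1 \<in> edge_ideal E}"
      by (simp add: edge_ideal_eq_mono_ideal mono_ideal_def)
  next
    fix r :: "('v, 'k) polynomials"
    assume "r \<in> {r \<in> carrier vertex_ring. r \<otimes>\<^bsub>vertex_ring\<^esub> Poly_Mapping.single m0 1 \<in> edge_ideal E}"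
    then show "r \<in> ?p"
      using add_mem_keys_mult_single[of _ r m0] key
      by (auto simp: edge_ideal_eq_mono_ideal mono_ideal_def subset_eq)
  qed
  then show ?thesis
    unfolding associated_primes_def
    by (intro CollectI conjI bexI primeideal_wdeg_pos) (assumption, simp)
qed

text \<open>In a cover of least size inside \<open>W\<close>, a vertex with all neighbours in the
  cover could be dropped.\<close>

lemma minimal_vertex_cover:
  fixes E :: "'v::finite set set"
  assumes E: "simple_graph E" and "vertex_cover E W"
  obtains W' where "W' \<subseteq> W" "vertex_cover E W'" "\<And>v. v \<in> W' \<Longrightarrow> \<exists>u. u \<notin> W' \<and> {u, v} \<in> E"
proof -
  obtain W' where W': "W' \<subseteq> W" "vertex_cover E W'"
    and least: "\<And>U. U \<subseteq> W \<Longrightarrow> vertex_cover E U \<Longrightarrow> card W' \<le> card U"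
    using ex_has_least_nat[of "\<lambda>U. U \<subseteq> W \<and> vertex_cover E U" W card] assms by blast
  have "\<exists>u. u \<notin> W' \<and> {u, v} \<in> E" if "v \<in> W'" for v
  proof (rule ccontr)
    assume "\<not> ?thesis"
    then have nbrs: "u \<in> W'" if "{u, v} \<in> E" for u using that by blast
    have "\<not> vertex_cover E (W' - {v})"
      using least[of "W' - {v}"] W' card_Diff1_less[of W' v] that by (auto simp: leD)
    then obtain a b where ab: "{a, b} \<in> E" "a \<notin> W' - {v}" "b \<notin> W' - {v}"
      by (auto simp: vertex_cover_def)
    moreover have "{b, a} \<in> E" using ab(1) by (simp add: insert_commute)
    ultimately have "a = v \<and> b = v"
      using nbrs[of a] nbrs[of b] vertex_coverD[OF W'(2), of a b] by blast
    then show False using simple_graph_neq[OF E ab(1)] by simp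
  qed
  then show thesis by (rule that[OF W'])
qed

text \<open>After shrinking \<open>W\<close> to a minimal cover, its prime is associated and yields
  a multiplier \<open>u\<close> with a term of weight 0. The lowest forms of \<open>u\<close> and
  \<open>f\<close> then give a term of \<open>u * f\<close> no heavier than \<open>m\<close>, yet it
  contains \<open>s\<close> edges that each meet the cover.\<close>

lemma symbolic_power_cover_weight:
  fixes E :: "'v::finite set set" and f :: "('v, 'k::field) polynomials"
  assumes E: "simple_graph E" and f: "f \<in> symbolic_power vertex_ring (edge_ideal E) s"
    and m: "m \<in> Poly_Mapping.keys f" and W: "vertex_cover E W"
  shows "s \<le> sum (Poly_Mapping.lookup m) W"
proof -
  obtain W' where W': "W' \<subseteq> W" "vertex_cover E W'" "\<And>v. v \<in> W' \<Longrightarrow> \<exists>u. u \<notin> W' \<and> {u, v} \<in> E"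
    by (rule minimal_vertex_cover[OF E W], rule that)
  define w :: "'v \<Rightarrow> nat" where "w v = of_bool (v \<in> W')" for v
  let ?p = "mono_ideal {m. wdeg w m > 0} :: ('v, 'k) polynomials set"
  have "?p \<in> associated_primes vertex_ring (edge_ideal E)"
    unfolding w_def by (rule cover_prime_associated[OF E W'(2,3)])
  then have "f \<in> localized_contraction vertex_ring ?p (ideal_power vertex_ring (edge_ideal E) s)"
    using f by (simp add: symbolic_power_def)
  then obtain u where u: "u \<notin> ?p" "u * f \<in> mono_ideal (sumset_pow (edge_monos E) s)"
    unfolding localized_contraction_iff[OF primeideal_wdeg_pos ideal_ideal_power_edge_ideal]
    by (auto simp only: ideal_power_edge_ideal)
  then obtain a0 where a0: "a0 \<in> Poly_Mapping.keys u" "wdeg w a0 = 0" by (auto simp: mono_ideal_def)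
  with m have "u \<noteq> 0" "f \<noteq> 0" by auto
  then obtain a b where ab: "a + b \<in> Poly_Mapping.keys (u * f)"
    and min: "wdeg w a \<le> wdeg w a0" "wdeg w b \<le> wdeg w m"
    using keys_mult_minimal[of u f w] a0(1) m by metis
  have "1 \<le> wdeg w c" if "c \<in> edge_monos E" for c
    using that
  proof (rule wdeg_edge_monos)
    show "1 \<le> w u + w v" if "{u, v} \<in> E" for u v
      using vertex_coverD[OF W'(2) that] by (auto simp: w_def)
  qed
  moreover have "a + b \<in> sumset_pow (edge_monos E) s" using u(2) ab by (auto simp: mono_ideal_def)
  ultimately have "s * 1 \<le> wdeg w (a + b)" by (rule wdeg_sumset_pow[rotated])
  also have "\<dots> \<le> wdeg w m" using min a0(2) by (simp add: wdeg_add)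
  also have "\<dots> = sum (Poly_Mapping.lookup m) W'" unfolding w_def by (rule wdeg_of_bool)
  also have "\<dots> \<le> sum (Poly_Mapping.lookup m) W" using W'(1) by (simp add: sum_mono2)
  finally show ?thesis by simp
qed

text \<open>Let \<open>p\<close> annihilate the class of \<open>g\<close>, and let \<open>a\<close>
  be a term of \<open>g\<close> without an edge. Multiplying \<open>a\<close> by \<open>v\<close>
  creates an edge, whose other end \<open>u\<close> already divides \<open>a\<close>. Multiplying by
  \<open>u\<close> leaves the support of \<open>a\<close> unchanged and creates none, so
  \<open>var u\<close> is not in \<open>p\<close>.\<close>

lemma associated_prime_neighbour:
  fixes E :: "'v::finite set set" and p :: "('v, 'k::field) polynomials set"
  assumes E: "simple_graph E" and p: "p \<in> associated_primes vertex_ring (edge_ideal E)"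
    and v: "var v \<in> p"
  shows "\<exists>u. {u, v} \<in> E \<and> var u \<notin> p"
proof -
  obtain g where prime: "primeideal p vertex_ring" and pg: "\<And>r. r \<in> p \<longleftrightarrow> r * g \<in> edge_ideal E"
    using p by (auto simp: associated_primes_def)
  have "g \<notin> edge_ideal E" using prime_of_type_algebraD(1)[OF prime] pg[of 1] by simp
  then obtain a where a: "a \<in> Poly_Mapping.keys g" "a \<notin> edge_monos E"
    by (auto simp: edge_ideal_eq_mono_ideal mono_ideal_def)
  have keys: "a + unit_exp x \<in> edge_monos E" if "var x \<in> p" for x
  proof -
    have "a + unit_exp x \<in> Poly_Mapping.keys (g * var x)"
      unfolding var_def by (rule add_mem_keys_mult_single[OF a(1)])
    also have "\<dots> \<subseteq> edge_monos E"
      using that pg[of "var x"] by (simp add: edge_ideal_eq_mono_ideal mono_ideal_def mult.commute)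
    finally show ?thesis .
  qed
  obtain u where u: "{u, v} \<in> E" "Poly_Mapping.lookup a u > 0"
  proof -
    obtain x y where xy: "{x, y} \<in> E" "Poly_Mapping.lookup (a + unit_exp v) x > 0"
      "Poly_Mapping.lookup (a + unit_exp v) y > 0"
      using keys[OF v] unfolding edge_monos_iff[OF E] by blast
    have "x \<noteq> y" using simple_graph_neq[OF E xy(1)] .
    have "\<not> (Poly_Mapping.lookup a x > 0 \<and> Poly_Mapping.lookup a y > 0)"
      using a(2) xy(1) unfolding edge_monos_iff[OF E] by blast
    then have "x = v \<and> Poly_Mapping.lookup a y > 0 \<or> y = v \<and> Poly_Mapping.lookup a x > 0"
      using xy(2,3) \<open>x \<noteq> y\<close> by (auto simp: lookup_add lookup_single when_def split: if_splits)
    then show thesis using that[of x] that[of y] xy(1) by (auto simp: insert_commute)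
  qed
  have "var u \<notin> p"
  proof
    assume "var u \<in> p"
    then obtain x y where "{x, y} \<in> E" "Poly_Mapping.lookup (a + unit_exp u) x > 0"
      "Poly_Mapping.lookup (a + unit_exp u) y > 0"
      using keys unfolding edge_monos_iff[OF E] by blast
    then have "{x, y} \<in> E" "Poly_Mapping.lookup a x > 0" "Poly_Mapping.lookup a y > 0"
      using u(2) by (auto simp: lookup_add lookup_single when_def split: if_splits)
    then show False using a(2) unfolding edge_monos_iff[OF E] by blast
  qed
  then show ?thesis using u(1) by blast
qed

text \<open>The variables in an associated prime form a cover \<open>C\<close>. Each unit of weight
  on \<open>C\<close> is completed to an edge by a neighbour whose variable is outside
  \<open>p\<close>; the product of these variables is the multiplier.\<close>

lemma monomial_in_symbolic_power:
  fixes E :: "'v::finite set set"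
  assumes E: "simple_graph E"
    and covers: "\<And>W. vertex_cover E W \<Longrightarrow> s \<le> sum (Poly_Mapping.lookup m) W"
  shows "(Poly_Mapping.single m 1 :: ('v, 'k::field) polynomials)
    \<in> symbolic_power vertex_ring (edge_ideal E) s"
  unfolding symbolic_power_def
proof (intro IntI INT_I)
  fix p :: "('v, 'k) polynomials set"
  assume p: "p \<in> associated_primes vertex_ring (edge_ideal E)"
  then obtain g where prime: "primeideal p vertex_ring" and pg: "\<And>r. r \<in> p \<longleftrightarrow> r * g \<in> edge_ideal E"
    by (auto simp: associated_primes_def)
  define C where "C = {v. (var v :: ('v, 'k) polynomials) \<in> p}"
  have "vertex_cover E C"
    unfolding vertex_cover_def C_def mem_Collect_eq
  proof (intro allI impI)
    fix u v assume "{u, v} \<in> E"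
    then have "var u * var v \<in> (edge_ideal E :: ('v, 'k) polynomials set)"
      using edge_in_edge_monos
      by (simp add: edge_ideal_eq_mono_ideal var_def mult_single mono_ideal_def del: One_nat_def)
    then have "g * (var u * var v) \<in> edge_ideal E"
      using ideal_of_type_algebraD(3)[OF ideal_mono_ideal[OF up_closed_edge_monos]]
      unfolding edge_ideal_eq_mono_ideal by blast
    then have "var u * var v \<in> p" by (simp add: pg mult.commute)
    then show "var u \<in> p \<or> var v \<in> p" by (rule prime_of_type_algebraD(2)[OF prime])
  qed
  \<comment> \<open>Only the weight on \<open>C\<close> is carried through the induction: it drops
    by exactly one when a factor \<open>v\<close> is removed.\<close>
  have "\<exists>U. U \<notin> p \<and> U * Poly_Mapping.single m 1 \<in> mono_ideal (sumset_pow (edge_monos E) s)"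
    if "s \<le> sum (Poly_Mapping.lookup m) C" for s m
    using that
  proof (induction s arbitrary: m)
    case 0
    then show ?case
      using prime_of_type_algebraD(1)[OF prime] by (intro exI[of _ 1]) (simp add: mono_ideal_def)
  next
    case (Suc s)
    then have "sum (Poly_Mapping.lookup m) C > 0" by linarith
    then obtain v where v: "v \<in> C" "Poly_Mapping.lookup m v > 0"
      unfolding neq0_conv[symmetric] by (auto simp only: sum_eq_0_iff finite)
    then obtain u where u: "{u, v} \<in> E" "(var u :: ('v, 'k) polynomials) \<notin> p"
      using associated_prime_neighbour[OF E p] by (auto simp: C_def)
    have m: "m = m - unit_exp v + unit_exp v"
      using v(2) by (intro poly_mapping_eqI) (auto simp: lookup_add lookup_minus lookup_single when_def)
    have "sum (Poly_Mapping.lookup m) C = sum (Poly_Mapping.lookup (m - unit_exp v)) C + 1"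
      by (subst m) (use v(1) in \<open>simp only: wdeg_of_bool[symmetric] wdeg_add wdeg_single; simp\<close>)
    then obtain U where U: "U \<notin> p"
      "U * Poly_Mapping.single (m - unit_exp v) 1 \<in> mono_ideal (sumset_pow (edge_monos E) s)"
      using Suc.IH[of "m - unit_exp v"] Suc.prems by auto
    have "U * var u \<notin> p" using U(1) u(2) prime_of_type_algebraD(2)[OF prime] by blast
    moreover have "(U * Poly_Mapping.single (m - unit_exp v) 1) *
        Poly_Mapping.single (unit_exp u + unit_exp v) 1 \<in> mono_ideal (sumset_pow (edge_monos E) (Suc s))"
      unfolding sumset_pow.simps using u(1)
      by (intro mono_ideal_mult U(2)) (simp only: single_mem_mono_ideal_iff edge_in_edge_monos)
    moreover have "(U * Poly_Mapping.single (m - unit_exp v) 1) *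
        Poly_Mapping.single (unit_exp u + unit_exp v) 1 = (U * var u) * Poly_Mapping.single m 1"
    proof -
      have "m - unit_exp v + (unit_exp u + unit_exp v) = unit_exp u + m"
        by (subst (2) m) (simp only: ac_simps)
      then show ?thesis by (simp only: var_def mult_single mult.assoc mult_1_left)
    qed
    ultimately show ?case by metis
  qed
  then have "\<exists>U. U \<notin> p \<and> U * Poly_Mapping.single m 1 \<in> mono_ideal (sumset_pow (edge_monos E) s)"
    using covers[OF \<open>vertex_cover E C\<close>] by blast
  then show "Poly_Mapping.single m 1 \<in>
      localized_contraction vertex_ring p (ideal_power vertex_ring (edge_ideal E) s)"
    unfolding localized_contraction_iff[OF prime ideal_ideal_power_edge_ideal]
    by (simp only: ideal_power_edge_ideal)
qed simp

section \<open>Multiplication by powers of the maximal ideal\<close>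

text \<open>Term by term: the first factor supplies a heavy vertex and the second the cover weights,
  and adding exponents preserves both.\<close>

lemma max_ideal_power_product_subset:
  fixes E :: "'v::finite set set"
  assumes E: "simple_graph E"
    and cycles: "\<And>v xs. is_cycle E xs \<Longrightarrow> \<exists>x\<in>set xs. {v, x} \<in> E"
  shows "ideal_prod vertex_ring (ideal_power vertex_ring max_ideal (s * card (UNIV :: 'v set)))
      (symbolic_power vertex_ring (edge_ideal E) s)
    \<subseteq> (ideal_power vertex_ring (edge_ideal E) s :: ('v, 'k::field) polynomials set)"
proof (rule ideal_prod_subset[OF ideal_ideal_power_edge_ideal])
  define M :: "('v \<Rightarrow>\<^sub>0 nat) set" where "M = sumset (range unit_exp) UNIV"
  define \<gamma> where "\<gamma> = s * card (UNIV :: 'v set)"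
  have M: "up_closed M" unfolding M_def by (rule up_closed_sumset) (simp add: up_closed_def)
  fix f g :: "('v, 'k) polynomials"
  assume "f \<in> ideal_power vertex_ring max_ideal (s * card (UNIV :: 'v set))"
  then have f: "Poly_Mapping.keys f \<subseteq> sumset_pow M \<gamma>"
    unfolding max_ideal_eq_mono_ideal M_def[symmetric] \<gamma>_def[symmetric] ideal_power_mono_ideal[OF M]
    by (simp add: mono_ideal_def)
  assume g: "g \<in> symbolic_power vertex_ring (edge_ideal E) s"
  have "a + b \<in> sumset_pow (edge_monos E) s"
    if a: "a \<in> Poly_Mapping.keys f" and b: "b \<in> Poly_Mapping.keys g" for a b
  proof -
    have "1 \<le> wdeg (\<lambda>_. 1) c" if "c \<in> M" for c
      using that by (auto simp: M_def sumset_def wdeg_add)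
    then have "\<gamma> * 1 \<le> wdeg (\<lambda>_. 1) a"
      using a f by (intro wdeg_sumset_pow[of a M]) auto
    then have deg: "s * card (UNIV :: 'v set) \<le> (\<Sum>v\<in>UNIV. Poly_Mapping.lookup a v)"
      by (simp add: wdeg_def \<gamma>_def)
    \<comment> \<open>Pigeonhole: if all exponents were below \<open>s\<close>, the degree would be
      below \<open>s\<close> times the number of vertices.\<close>
    obtain v where v: "s \<le> Poly_Mapping.lookup a v"
    proof (rule ccontr)
      assume "\<not> thesis"
      then have "Poly_Mapping.lookup a v < s" for v using that by (meson not_less)
      then have "(\<Sum>v\<in>UNIV. Poly_Mapping.lookup a v) < (\<Sum>v\<in>(UNIV :: 'v set). s)"
        by (intro sum_strict_mono) auto
      then show False using deg by (simp add: mult.commute)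
    qed
    show ?thesis
    proof (rule heavy_vertex_product_of_edges[OF E, of v])
      show "s \<le> Poly_Mapping.lookup (a + b) v" using v by (simp add: lookup_add)
      show "\<exists>x\<in>set xs. {v, x} \<in> E" if "is_cycle E xs" for xs by (rule cycles[OF that])
      fix W assume W: "vertex_cover E W"
      have "s \<le> sum (Poly_Mapping.lookup b) W"
        by (rule symbolic_power_cover_weight[OF E g b W])
      then show "s \<le> sum (Poly_Mapping.lookup (a + b)) W" by (simp add: lookup_add sum.distrib)
    qed
  qed
  then show "f * g \<in> ideal_power vertex_ring (edge_ideal E) s"
    unfolding ideal_power_edge_ideal mono_ideal_def using keys_mult[of f g] by blast
qed

lemma max_ideal_power_product_not_subset:
  fixes E :: "'v::finite set set"
  assumes E: "simple_graph E" and cycle: "is_cycle E xs" and len: "length xs = 2 * n + 1"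
    and s: "s \<ge> n + 1" and z: "z \<notin> closed_nbhd E (set xs)"
  shows "\<not> ideal_prod vertex_ring (ideal_power vertex_ring max_ideal \<gamma>)
      (symbolic_power vertex_ring (edge_ideal E) s)
    \<subseteq> (ideal_power vertex_ring (edge_ideal E) s :: ('v, 'k::field) polynomials set)"
proof
  assume sub: "ideal_prod vertex_ring (ideal_power vertex_ring max_ideal \<gamma>)
      (symbolic_power vertex_ring (edge_ideal E) s)
    \<subseteq> (ideal_power vertex_ring (edge_ideal E) s :: ('v, 'k) polynomials set)"
  \<comment> \<open>A cover meets the cycle in at least \<open>n + 1\<close> vertices, and each of
    the \<open>k\<close> extra copies of an edge adds at least 1, for a total of
    \<open>s\<close>.\<close>
  define k where "k = s - (n + 1)"
  define m where "m = (\<Sum>x\<in>set xs. unit_exp x) +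
    (Poly_Mapping.single (xs ! 0) k + Poly_Mapping.single (xs ! 1) k)"
  have len3: "length xs \<ge> 3" and dist: "distinct xs" using cycle by (auto simp: is_cycle_def)
  have edge: "{xs ! 0, xs ! 1} \<in> E" 
  proof -
    have "0 < length xs" "Suc 0 mod length xs = 1" using len3 by (auto intro: mod_less)
    then show ?thesis using cycle_edge[OF cycle, of 0] by simp
  qed
  have wdeg_m: "wdeg w m = (\<Sum>x\<in>set xs. w x) + (w (xs ! 0) + w (xs ! 1)) * k" for w
    by (simp add: m_def wdeg_add wdeg_sum add_mult_distrib)
  have "(Poly_Mapping.single m 1 :: ('v, 'k) polynomials) \<in> symbolic_power vertex_ring (edge_ideal E) s"
  proof (rule monomial_in_symbolic_power[OF E])
    fix W assume W: "vertex_cover E W"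
    have "1 * k \<le> (of_bool (xs ! 0 \<in> W) + of_bool (xs ! 1 \<in> W)) * k"
      using vertex_coverD[OF W edge] by (intro mult_le_mono1) auto
    then have "n + 1 + 1 * k \<le> sum (Poly_Mapping.lookup m) W"
      using odd_cycle_cover[OF cycle len W]
      unfolding wdeg_of_bool[symmetric] wdeg_m by (intro add_mono)
    then show "s \<le> sum (Poly_Mapping.lookup m) W" using s by (simp add: k_def)
  qed
  moreover have "(Poly_Mapping.single (Poly_Mapping.single z \<gamma>) 1 :: ('v, 'k) polynomials)
      \<in> ideal_power vertex_ring max_ideal \<gamma>"
  proof -
    have "Poly_Mapping.single z j \<in> sumset_pow (sumset (range unit_exp) UNIV) j" for j
    proof (induction j)
      case (Suc j)
      have "unit_exp z + 0 \<in> sumset (range unit_exp) UNIV" by (rule sumsetI) auto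
      from sumsetI[OF Suc this] show ?case by (simp flip: single_add)
    qed simp
    moreover have "up_closed (sumset (range unit_exp) (UNIV :: ('v \<Rightarrow>\<^sub>0 nat) set))"
      by (rule up_closed_sumset) (simp add: up_closed_def)
    ultimately show ?thesis
      by (simp only: max_ideal_eq_mono_ideal ideal_power_mono_ideal single_mem_mono_ideal_iff)
  qed
  ultimately have "Poly_Mapping.single (Poly_Mapping.single z \<gamma>) 1 \<otimes>\<^bsub>vertex_ring\<^esub> Poly_Mapping.single m 1
      \<in> (ideal_power vertex_ring (edge_ideal E) s :: ('v, 'k) polynomials set)"
    using sub by (blast intro: ideal_prod.prod)
  then have mem: "Poly_Mapping.single z \<gamma> + m \<in> sumset_pow (edge_monos E) s"
    by (simp add: ideal_power_edge_ideal mult_single mono_ideal_def)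
  \<comment> \<open>A fractional obstruction: neighbours of \<open>z\<close> are off the cycle and
    have weight 2, so every edge weighs at least 2 although \<open>z\<close> weighs 0. A product of
    \<open>s\<close> edges needs weight \<open>2 * s\<close>, while the witness has
    \<open>2 * n + 1 + 2 * k\<close>, which is one less.\<close>
  define w :: "'v \<Rightarrow> nat" where "w v = (if v \<in> set xs then 1 else if v = z then 0 else 2)" for v
  have z_set: "z \<notin> set xs" using z by (simp add: closed_nbhd_def)
  have edge_weight: "2 \<le> w u + w v" if "{u, v} \<in> E" for u v
  proof -
    have "{v, u} \<in> E" using that by (simp add: insert_commute)
    then show ?thesis
      using z that simple_graph_neq[OF E that] by (auto simp: w_def closed_nbhd_def)
  qed
  have "2 \<le> wdeg w c" if "c \<in> edge_monos E" for c
    using that edge_weight by (rule wdeg_edge_monos)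
  then have "s * 2 \<le> wdeg w (Poly_Mapping.single z \<gamma> + m)" by (rule wdeg_sumset_pow[OF mem])
  also have "\<dots> = (2 * n + 1) + 2 * k"
  proof -
    have "(\<Sum>x\<in>set xs. w x) = 2 * n + 1"
      using len distinct_card[OF dist] by (simp add: w_def)
    moreover have "xs ! 0 \<in> set xs" "xs ! 1 \<in> set xs" using len3 by (auto intro: nth_mem)
    then have "w (xs ! 0) = 1" "w (xs ! 1) = 1" by (simp_all only: w_def if_True)
    moreover have "w z = 0" using z_set by (simp add: w_def)
    ultimately show ?thesis by (simp add: wdeg_add wdeg_m)
  qed
  finally show False using s by (simp add: k_def)
qed

theorem theorem5p1:
  fixes E :: "'v::finite set set" and xs :: "'v list" and n s :: nat
    and I \<mm> :: "('v, 'k::field) polynomials set"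
  assumes "unicyclic E"
    and "is_cycle E xs" and "length xs = 2 * n + 1" and "n \<ge> 1"
    and "I = edge_ideal E" and "\<mm> = max_ideal"
    and "s \<ge> n + 1"
  shows "(\<exists>\<gamma>::nat. ideal_prod vertex_ring (ideal_power vertex_ring \<mm> \<gamma>) (symbolic_power vertex_ring I s)
            \<subseteq> ideal_power vertex_ring I s)
     \<longleftrightarrow> (\<forall>v. v \<in> closed_nbhd E (set xs))"
proof
  have E: "simple_graph E" using assms(1) by (simp add: unicyclic_def)
  show "\<forall>v. v \<in> closed_nbhd E (set xs)"
    if "\<exists>\<gamma>::nat. ideal_prod vertex_ring (ideal_power vertex_ring \<mm> \<gamma>) (symbolic_power vertex_ring I s)
        \<subseteq> ideal_power vertex_ring I s"
    using that max_ideal_power_product_not_subset[OF E assms(2,3,7)] unfolding assms(5,6) by blast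
  assume nbhd: "\<forall>v. v \<in> closed_nbhd E (set xs)"
  \<comment> \<open>Every cycle has the vertices of \<open>xs\<close>, so the neighbourhood
    condition carries over to all cycles.\<close>
  have "\<exists>x\<in>set ys. {v, x} \<in> E" if "is_cycle E ys" for v ys
    using closed_nbhd_cycle_neighbour[OF assms(2)] nbhd unicyclic_cycle_set_eq[OF assms(1,2) that]
    by blast
  then show "\<exists>\<gamma>::nat. ideal_prod vertex_ring (ideal_power vertex_ring \<mm> \<gamma>) (symbolic_power vertex_ring I s)
      \<subseteq> ideal_power vertex_ring I s"
    unfolding assms(5,6) using max_ideal_power_product_subset[OF E] by blast
qed

end
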